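(* Let $\mathbb K$ be a field and let $\Phi=(A,A^*;E_i,E^*_i,i=0..d)$ be a Leonard system over $\mathbb K$. Then there exists a unique $TD$-$D$ canonical form for $\Phi$. This is $\Phi^\flat$, where $\flat$ denotes the $TD$-$D$ canonical map for $\Phi$.
   Context: $\mathrm{Mat}_{d+1}(\mathbb K)$ is the algebra of $(d+1)\times(d+1)$ matrices over $\mathbb K$, rows and columns indexed by $0,1,\dots,d$. A matrix is tridiagonal if every nonzero entry lies on the diagonal, subdiagonal or superdiagonal. Leonard systems. Let $\mathcal A$ be a $\mathbb K$-algebra isomorphic to $\mathrm{Mat}_{d+1}(\mathbb K)$. An element $A\in\mathcal A$ is multiplicity-free if it has $d+1$ distinct eigenvalues in $\mathbb K$; if these are $\theta_0,\dots,\theta_d$, the primitive idempotent of $A$ associated with $\theta_i$ is $E_i=\prod_{j\ne i}(A-\theta_jI)/(\theta_i-\theta_j)$. For multiplicity-free $A,A^*\in\mathcal A$ ($A^*$ is just a name, not an adjoint), an idempotent sequence for $A,A^*$ is an ordering $E_0,\dots,E_d$ of the primitive idempotents of $A$ such that $E_iA^*E_j=0$ if $|i-j|>1$ and $E_iA^*E_j\ne0$ if $|i-j|=1$ ($0\le i,j\le d$); a dual idempotent sequence for $A,A^*$ is an idempotent sequence for $A^*,A$. A Leonard system in $\mathcal A$ (with ambient algebra $\mathcal A$, over $\mathbb K$) is a sequence $\Phi=(A,A^*;E_i,E^*_i,i=0..d)$ where $A,A^*\in\mathcal A$ are multiplicity-free, $E_0,\dots,E_d$ is an idempotent sequence for $A,A^*$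 and $E^*_0,\dots,E^*_d$ is a dual idempotent sequence for $A,A^*$. The eigenvalue sequence (resp. dual eigenvalue sequence) of $\Phi$ is $\theta_0,\dots,\theta_d$ (resp. $\theta^*_0,\dots,\theta^*_d$), where $\theta_i$ (resp. $\theta^*_i$) is the eigenvalue of $A$ (resp. $A^*$) associated with $E_i$ (resp. $E^*_i$). Isomorphism. For a $\mathbb K$-algebra isomorphism $\sigma:\mathcal A\to\mathcal A'$, $\Phi^\sigma:=(A^\sigma,A^{*\sigma};E_i^\sigma,E_i^{*\sigma},i=0..d)$ is a Leonard system in $\mathcal A'$. Leonard systems $\Phi,\Phi'$ are isomorphic if $\Phi^\sigma=\Phi'$ for some $\mathbb K$-algebra isomorphism $\sigma$ between their ambient algebras. $TD$-$D$ canonical form. A Leonard system with eigenvalue sequence $\theta_0,\dots,\theta_d$ and dual eigenvalue sequence $\theta^*_0,\dots,\theta^*_d$ is in $TD$-$D$ canonical form if (i) its ambient algebra is $\mathrm{Mat}_{d+1}(\mathbb K)$; (ii) $A$ is tridiagonal and $A^*$ is diagonal; (iii) every row sum of $A$ equals $\theta_0$, and $A^*_{00}=\theta^*_0$. A $TD$-$D$ canonical form for $\Phi$ is a Leonard system over $\mathbb K$ which is isomorphic to $\Phi$ and which is in $TD$-$D$ canonical form. $TD$-$D$ canonical map. Let $V$ be an irreducible left $\mathcal A$-module (unique up to isomorphism, of dimension $d+1$). It is known that for a nonzero vector $\eta_0\in E_0V$ the sequence $E^*_0\eta_0,E^*_1\eta_0,\dots,E^*_d\eta_0$ is a basis of $V$;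 such a basis is called a $\Phi$-$TD$-$D$ basis. For $X\in\mathcal A$ let $X^\flat\in\mathrm{Mat}_{d+1}(\mathbb K)$ be the matrix representing $X$ with respect to a $\Phi$-$TD$-$D$ basis ($Y$ represents $X$ with respect to $v_0,\dots,v_d$ if $Xv_j=\sum_iY_{ij}v_i$ for all $j$). The resulting $\mathbb K$-algebra isomorphism $\flat:\mathcal A\to\mathrm{Mat}_{d+1}(\mathbb K)$ (independent of choices, since $\dim E_0V=1$) is the $TD$-$D$ canonical map for $\Phi$. *)

theory Defs
  imports "Jordan_Normal_Form.VS_Connect" "Jordan_Normal_Form.Char_Poly"
begin


text \<open>
  The field is a type of class \<open>field\<close>, seen as the HOL-Algebra ring \<open>class_ring\<close>.
  A \<open>K\<close>-algebra is carried by a \<open>module\<close> record, all of whose fields (including the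
  multiplicative ones) are used. The HOL-Algebra locale \<open>algebra\<close> cannot be used because it
  requires commutativity. \<open>Mat\<^sub>n(K)\<close> is the library's \<open>module_mat TYPE('k) n n\<close>.
\<close>

locale k_algebra = Module.module class_ring M + ring M
  for M :: "('k::field, 'a) module" (structure) +
  assumes smult_mult_left: "x \<in> carrier M \<Longrightarrow> y \<in> carrier M \<Longrightarrow> (c \<odot> x) \<otimes> y = c \<odot> (x \<otimes> y)"
    and smult_mult_right: "x \<in> carrier M \<Longrightarrow> y \<in> carrier M \<Longrightarrow> x \<otimes> (c \<odot> y) = c \<odot> (x \<otimes> y)"

definition alg_iso :: "('k::field, 'a) module \<Rightarrow> ('k, 'b) module \<Rightarrow> ('a \<Rightarrow> 'b) set" where
  "alg_iso M N = {\<sigma> \<in> Ring.ring_hom M N. bij_betw \<sigma> (carrier M) (carrier N) \<and>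
     (\<forall>c. \<forall>x\<in>carrier M. \<sigma> (c \<odot>\<^bsub>M\<^esub> x) = c \<odot>\<^bsub>N\<^esub> \<sigma> x)}"

abbreviation Mat_alg :: "nat \<Rightarrow> ('k::field, 'k mat) module" where
  "Mat_alg n \<equiv> module_mat TYPE('k) n n"

lemma k_algebra_Mat_alg: "k_algebra (Mat_alg n :: ('k::field,'k mat) module)"
proof -
  interpret V: vectorspace "class_ring :: 'k ring" "Mat_alg n :: ('k,'k mat) module" by (rule matrix_vs)
  interpret R: ring "ring_mat TYPE('k) n undefined" by (rule ring_mat)
  have "ring (Mat_alg n :: ('k,'k mat) module)"
    by (unfold_locales) (auto simp: module_mat_def add_mult_distrib_mat mult_add_distrib_mat assoc_mult_mat)
  then show ?thesis unfolding k_algebra_def k_algebra_axioms_def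
    using V.module_axioms by (auto simp: module_mat_def)
qed

text \<open>
  An eigenvalue of an element of an algebra isomorphic to \<open>Mat\<^sub>n(K)\<close> is an eigenvalue of the
  corresponding matrix. The choice of isomorphism is irrelevant: \<open>\<theta>\<close> is an eigenvalue
  of \<open>\<sigma>(X)\<close> iff \<open>\<sigma>(X) - \<theta>I\<close> is not invertible, iff \<open>X - \<theta>1\<close> is not invertible.
\<close>

definition alg_eigenvalue :: "('k::field, 'a) module \<Rightarrow> nat \<Rightarrow> 'a \<Rightarrow> 'k \<Rightarrow> bool" where
  "alg_eigenvalue M n X \<theta> \<longleftrightarrow> (\<exists>\<sigma>\<in>alg_iso M (Mat_alg n). eigenvalue (\<sigma> X) \<theta>)"

definition multiplicity_free :: "('k::field, 'a) module \<Rightarrow> nat \<Rightarrow> 'a \<Rightarrow> bool" where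
  "multiplicity_free M d X \<longleftrightarrow>
     X \<in> carrier M \<and> card {\<theta>. alg_eigenvalue M (Suc d) X \<theta>} = Suc d"

text \<open>
  The product of \<open>(X - \<theta>\<^sub>j 1)/(\<theta>\<^sub>i - \<theta>\<^sub>j)\<close> over \<open>j \<noteq> i\<close>. The factors commute, but the algebra does
  not, so the product is written over a list.
\<close>

definition primitive_idempotent :: "('k::field, 'a) module \<Rightarrow> 'a \<Rightarrow> 'k list \<Rightarrow> nat \<Rightarrow> 'a" where
  "primitive_idempotent M X \<theta>s i =
     foldr (\<lambda>j Y. (inverse (\<theta>s ! i - \<theta>s ! j) \<odot>\<^bsub>M\<^esub> (X \<ominus>\<^bsub>M\<^esub> \<theta>s ! j \<odot>\<^bsub>M\<^esub> \<one>\<^bsub>M\<^esub>)) \<otimes>\<^bsub>M\<^esub> Y)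
       (filter (\<lambda>j. j \<noteq> i) [0..<length \<theta>s]) \<one>\<^bsub>M\<^esub>"

text \<open>
  \<open>\<theta>s\<close> lists the eigenvalues of \<open>X\<close>, and \<open>Es\<close> lists the corresponding primitive idempotents of
  \<open>X\<close> in the same order.
\<close>

definition eigenvalue_order ::
    "('k::field, 'a) module \<Rightarrow> nat \<Rightarrow> 'a \<Rightarrow> 'a list \<Rightarrow> 'k list \<Rightarrow> bool" where
  "eigenvalue_order M d X Es \<theta>s \<longleftrightarrow>
     length \<theta>s = Suc d \<and> distinct \<theta>s \<and> set \<theta>s = {\<theta>. alg_eigenvalue M (Suc d) X \<theta>} \<and>
     Es = map (primitive_idempotent M X \<theta>s) [0..<Suc d]"

definition idempotent_sequence ::
    "('k::field, 'a) module \<Rightarrow> nat \<Rightarrow> 'a \<Rightarrow> 'a \<Rightarrow> 'a list \<Rightarrow> bool" where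
  "idempotent_sequence M d X Y Es \<longleftrightarrow>
     (\<exists>\<theta>s. eigenvalue_order M d X Es \<theta>s) \<and>
     (\<forall>i\<le>d. \<forall>j\<le>d.
        (\<bar>int i - int j\<bar> > 1 \<longrightarrow> Es ! i \<otimes>\<^bsub>M\<^esub> Y \<otimes>\<^bsub>M\<^esub> Es ! j = \<zero>\<^bsub>M\<^esub>) \<and>
        (\<bar>int i - int j\<bar> = 1 \<longrightarrow> Es ! i \<otimes>\<^bsub>M\<^esub> Y \<otimes>\<^bsub>M\<^esub> Es ! j \<noteq> \<zero>\<^bsub>M\<^esub>))"

text \<open>
  The data \<open>\<Phi> = (A, A\<^sup>*; E\<^sub>i, E\<^sup>*\<^sub>i, i = 0..d)\<close> together with its ambient algebra. The sequences
  are lists of length \<open>d + 1\<close>, so that equality of records is equality of systems.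
\<close>

record ('k, 'a) leonard_data =
  ls_alg :: "('k, 'a) module"
  ls_d :: nat
  ls_A :: 'a
  ls_Astar :: 'a
  ls_E :: "'a list"
  ls_Estar :: "'a list"

definition leonard_system :: "('k::field, 'a) leonard_data \<Rightarrow> bool" where
  "leonard_system \<Phi> \<longleftrightarrow>
     k_algebra (ls_alg \<Phi>) \<and> alg_iso (ls_alg \<Phi>) (Mat_alg (Suc (ls_d \<Phi>))) \<noteq> {} \<and>
     multiplicity_free (ls_alg \<Phi>) (ls_d \<Phi>) (ls_A \<Phi>) \<and>
     multiplicity_free (ls_alg \<Phi>) (ls_d \<Phi>) (ls_Astar \<Phi>) \<and>
     idempotent_sequence (ls_alg \<Phi>) (ls_d \<Phi>) (ls_A \<Phi>) (ls_Astar \<Phi>) (ls_E \<Phi>) \<and>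
     idempotent_sequence (ls_alg \<Phi>) (ls_d \<Phi>) (ls_Astar \<Phi>) (ls_A \<Phi>) (ls_Estar \<Phi>)"

definition eigenvalue_sequence :: "('k::field, 'a) leonard_data \<Rightarrow> 'k list \<Rightarrow> bool" where
  "eigenvalue_sequence \<Phi> \<theta>s \<longleftrightarrow> eigenvalue_order (ls_alg \<Phi>) (ls_d \<Phi>) (ls_A \<Phi>) (ls_E \<Phi>) \<theta>s"

definition dual_eigenvalue_sequence :: "('k::field, 'a) leonard_data \<Rightarrow> 'k list \<Rightarrow> bool" where
  "dual_eigenvalue_sequence \<Phi> \<theta>s \<longleftrightarrow>
     eigenvalue_order (ls_alg \<Phi>) (ls_d \<Phi>) (ls_Astar \<Phi>) (ls_Estar \<Phi>) \<theta>s"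

text \<open>The system \<open>\<Phi>\<^sup>\<sigma>\<close> for a map \<open>\<sigma>\<close> from the ambient algebra of \<open>\<Phi>\<close> to \<open>N\<close>.\<close>

definition map_system ::
    "('k, 'b) module \<Rightarrow> ('a \<Rightarrow> 'b) \<Rightarrow> ('k, 'a) leonard_data \<Rightarrow> ('k, 'b) leonard_data" where
  "map_system N \<sigma> \<Phi> =
     \<lparr>ls_alg = N, ls_d = ls_d \<Phi>, ls_A = \<sigma> (ls_A \<Phi>), ls_Astar = \<sigma> (ls_Astar \<Phi>),
      ls_E = map \<sigma> (ls_E \<Phi>), ls_Estar = map \<sigma> (ls_Estar \<Phi>)\<rparr>"

definition isomorphic_systems ::
    "('k::field, 'a) leonard_data \<Rightarrow> ('k, 'b) leonard_data \<Rightarrow> bool" where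
  "isomorphic_systems \<Phi> \<Phi>' \<longleftrightarrow>
     (\<exists>\<sigma>\<in>alg_iso (ls_alg \<Phi>) (ls_alg \<Phi>'). map_system (ls_alg \<Phi>') \<sigma> \<Phi> = \<Phi>')"

definition tridiagonal_mat :: "'k::zero mat \<Rightarrow> bool" where
  "tridiagonal_mat B \<longleftrightarrow>
     (\<forall>i<dim_row B. \<forall>j<dim_col B. B $$ (i, j) \<noteq> 0 \<longrightarrow> i = j \<or> i = Suc j \<or> j = Suc i)"

definition in_TDD_canonical_form :: "('k::field, 'k mat) leonard_data \<Rightarrow> bool" where
  "in_TDD_canonical_form \<Phi> \<longleftrightarrow>
     leonard_system \<Phi> \<and>
     ls_alg \<Phi> = Mat_alg (Suc (ls_d \<Phi>)) \<and>
     tridiagonal_mat (ls_A \<Phi>) \<and> diagonal_mat (ls_Astar \<Phi>) \<and>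
     (\<exists>\<theta>s \<theta>s'. eigenvalue_sequence \<Phi> \<theta>s \<and> dual_eigenvalue_sequence \<Phi> \<theta>s' \<and>
        (\<forall>i\<le>ls_d \<Phi>. (\<Sum>j\<le>ls_d \<Phi>. ls_A \<Phi> $$ (i, j)) = \<theta>s ! 0) \<and>
        ls_Astar \<Phi> $$ (0, 0) = \<theta>s' ! 0)"

definition TDD_canonical_form_for ::
    "('k::field, 'a) leonard_data \<Rightarrow> ('k, 'k mat) leonard_data \<Rightarrow> bool" where
  "TDD_canonical_form_for \<Phi> \<Psi> \<longleftrightarrow>
     leonard_system \<Psi> \<and> isomorphic_systems \<Phi> \<Psi> \<and> in_TDD_canonical_form \<Psi>"

text \<open>
  A left module over a \<open>K\<close>-algebra \<open>M\<close>: a \<open>K\<close>-vector space \<open>V\<close> (only the additive part and the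
  scalar multiplication of the record are used) with a bilinear, unital, associative action.
\<close>

locale left_alg_module = M: k_algebra M + V: vectorspace class_ring V
  for M :: "('k::field, 'a) module" and V :: "('k, 'v) module" +
  fixes act :: "'a \<Rightarrow> 'v \<Rightarrow> 'v"
  assumes act_closed: "X \<in> carrier M \<Longrightarrow> v \<in> carrier V \<Longrightarrow> act X v \<in> carrier V"
    and act_add_right: "X \<in> carrier M \<Longrightarrow> v \<in> carrier V \<Longrightarrow> w \<in> carrier V \<Longrightarrow>
      act X (v \<oplus>\<^bsub>V\<^esub> w) = act X v \<oplus>\<^bsub>V\<^esub> act X w"
    and act_add_left: "X \<in> carrier M \<Longrightarrow> Y \<in> carrier M \<Longrightarrow> v \<in> carrier V \<Longrightarrow>
      act (X \<oplus>\<^bsub>M\<^esub> Y) v = act X v \<oplus>\<^bsub>V\<^esub> act Y v"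
    and act_smult_right: "X \<in> carrier M \<Longrightarrow> v \<in> carrier V \<Longrightarrow>
      act X (c \<odot>\<^bsub>V\<^esub> v) = c \<odot>\<^bsub>V\<^esub> act X v"
    and act_smult_left: "X \<in> carrier M \<Longrightarrow> v \<in> carrier V \<Longrightarrow>
      act (c \<odot>\<^bsub>M\<^esub> X) v = c \<odot>\<^bsub>V\<^esub> act X v"
    and act_mult: "X \<in> carrier M \<Longrightarrow> Y \<in> carrier M \<Longrightarrow> v \<in> carrier V \<Longrightarrow>
      act (X \<otimes>\<^bsub>M\<^esub> Y) v = act X (act Y v)"
    and act_one: "v \<in> carrier V \<Longrightarrow> act \<one>\<^bsub>M\<^esub> v = v"

definition irreducible_left_module ::
    "('k::field, 'a) module \<Rightarrow> ('k, 'v) module \<Rightarrow> ('a \<Rightarrow> 'v \<Rightarrow> 'v) \<Rightarrow> bool" where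
  "irreducible_left_module M V act \<longleftrightarrow>
     left_alg_module M V act \<and> carrier V \<noteq> {\<zero>\<^bsub>V\<^esub>} \<and>
     (\<forall>W. submodule class_ring W V \<and> (\<forall>X\<in>carrier M. \<forall>w\<in>W. act X w \<in> W) \<longrightarrow>
        W = {\<zero>\<^bsub>V\<^esub>} \<or> W = carrier V)"

text \<open>
  Irreducible modules exist over every algebra considered here: transport the action of
  \<open>Mat\<^sub>n(K)\<close> on \<open>K\<^sup>n\<close> along an isomorphism.
\<close>

lemma irreducible_left_module_vec:
  fixes M :: "('k::field, 'a) module"
  assumes M: "k_algebra M" and \<sigma>: "\<sigma> \<in> alg_iso M (Mat_alg (Suc d))"
  shows "irreducible_left_module M (module_vec TYPE('k) (Suc d)) (\<lambda>X v. \<sigma> X *\<^sub>v v)"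
proof -
  let ?n = "Suc d"
  let ?V = "module_vec TYPE('k) ?n"
  interpret M: k_algebra M by (rule M)
  interpret V: vectorspace class_ring ?V by (rule vec_vs)
  have hom: "\<sigma> \<in> Ring.ring_hom M (Mat_alg ?n)"
    and bij: "bij_betw \<sigma> (carrier M) (carrier_mat ?n ?n)"
    and sm: "\<And>c x. x \<in> carrier M \<Longrightarrow> \<sigma> (c \<odot>\<^bsub>M\<^esub> x) = c \<cdot>\<^sub>m \<sigma> x"
    using \<sigma> by (auto simp: alg_iso_def module_mat_def)
  have cl: "\<sigma> x \<in> carrier_mat ?n ?n" if "x \<in> carrier M" for x
    using bij that by (auto simp: bij_betw_def)
  have add: "\<sigma> (x \<oplus>\<^bsub>M\<^esub> y) = \<sigma> x + \<sigma> y" if "x \<in> carrier M" "y \<in> carrier M" for x y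
    using ring_hom_add[OF hom that] by (simp add: module_mat_def)
  have mult: "\<sigma> (x \<otimes>\<^bsub>M\<^esub> y) = \<sigma> x * \<sigma> y" if "x \<in> carrier M" "y \<in> carrier M" for x y
    using ring_hom_mult[OF hom that] by (simp add: module_mat_def)
  have one: "\<sigma> \<one>\<^bsub>M\<^esub> = 1\<^sub>m ?n"
    using ring_hom_one[OF hom] by (simp add: module_mat_def)
  have left: "left_alg_module M ?V (\<lambda>X v. \<sigma> X *\<^sub>v v)"
  proof (unfold_locales, goal_cases)
    case (1 X v) then show ?case
      using mult_mat_vec_carrier[OF cl[of X]] by (auto simp: module_vec_simps)
  next
    case (2 X v w) then show ?case
      using cl[of X] by (auto simp: module_vec_simps intro!: mult_add_distrib_mat_vec)
  next
    case (3 X Y v) then show ?case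
      using cl[of X] cl[of Y] by (auto simp: module_vec_simps add intro!: add_mult_distrib_mat_vec)
  next
    case (4 X v c) then show ?case
      using cl[of X] by (auto simp: module_vec_simps intro!: mult_mat_vec)
  next
    case (5 X v c) then show ?case
      using cl[of X] by (auto simp: module_vec_simps sm)
  next
    case (6 X Y v) then show ?case
      using cl[of X] cl[of Y] by (auto simp: module_vec_simps mult intro!: assoc_mult_mat_vec)
  next
    case (7 v) then show ?case by (auto simp: module_vec_simps one)
  qed
  have "unit_vec ?n 0 \<in> carrier ?V" "unit_vec ?n 0 \<noteq> \<zero>\<^bsub>?V\<^esub>"
    by (auto simp: module_vec_simps)
  then have nz: "carrier ?V \<noteq> {\<zero>\<^bsub>?V\<^esub>}" by blast
  have "W = carrier ?V" if W: "submodule class_ring W ?V"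
    and inv: "\<And>X w. X \<in> carrier M \<Longrightarrow> w \<in> W \<Longrightarrow> \<sigma> X *\<^sub>v w \<in> W"
    and "W \<noteq> {\<zero>\<^bsub>?V\<^esub>}" for W
  proof -
    interpret W: submodule class_ring W ?V by (rule W)
    obtain w where w: "w \<in> W" "w \<noteq> 0\<^sub>v ?n"
      using W.zero_closed \<open>W \<noteq> _\<close> by (auto simp: module_vec_simps)
    then have wc: "w \<in> carrier_vec ?n" using W.subset by (auto simp: module_vec_simps)
    then obtain k where k: "k < ?n" "w $ k \<noteq> 0"
      using w(2) by (metis (no_types, lifting) carrier_vecD eq_vecI index_zero_vec)
    have "v \<in> W" if v: "v \<in> carrier_vec ?n" for v
    proof -
      let ?B = "mat ?n ?n (\<lambda>(i, j). if j = k then v $ i / w $ k else 0)"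
      have "?B \<in> carrier_mat ?n ?n" by simp
      then obtain X where X: "X \<in> carrier M" "\<sigma> X = ?B"
        using bij by (metis (no_types, lifting) bij_betw_def imageE)
      have "?B *\<^sub>v w = v"
      proof (rule eq_vecI)
        fix i assume i: "i < dim_vec v"
        then have "(?B *\<^sub>v w) $ i = (\<Sum>j\<in>{0..<?n}. (if j = k then v $ i / w $ k else 0) * w $ j)"
          using v wc by (auto simp: scalar_prod_def simp del: sum.op_ivl_Suc)
        also have "\<dots> = (\<Sum>j\<in>{0..<?n}. if j = k then v $ i else 0)"
          using k by (intro sum.cong) auto
        also have "\<dots> = v $ i" using k by (simp del: sum.op_ivl_Suc)
        finally show "(?B *\<^sub>v w) $ i = v $ i" .
      qed (use v in auto)
      then show ?thesis using inv[OF X(1) w(1)] X(2) by simp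
    qed
    then show ?thesis using W.subset by (auto simp: module_vec_simps)
  qed
  then show ?thesis using left nz unfolding irreducible_left_module_def by blast
qed

definition represents ::
    "('k::field, 'v) module \<Rightarrow> ('a \<Rightarrow> 'v \<Rightarrow> 'v) \<Rightarrow> nat \<Rightarrow> (nat \<Rightarrow> 'v) \<Rightarrow> 'k mat \<Rightarrow> 'a \<Rightarrow> bool" where
  "represents V act d v Y X \<longleftrightarrow>
     Y \<in> carrier_mat (Suc d) (Suc d) \<and>
     (\<forall>j\<le>d. act X (v j) = (\<Oplus>\<^bsub>V\<^esub>i\<in>{..d}. Y $$ (i, j) \<odot>\<^bsub>V\<^esub> v i))"

definition TDD_basis ::
    "('k, 'a) leonard_data \<Rightarrow> ('a \<Rightarrow> 'v \<Rightarrow> 'v) \<Rightarrow> 'v \<Rightarrow> nat \<Rightarrow> 'v" where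
  "TDD_basis \<Phi> act \<eta> i = act (ls_Estar \<Phi> ! i) \<eta>"

text \<open>
  The map \<open>X \<mapsto> X\<^sup>\<flat>\<close> computed from an irreducible module \<open>V\<close> and a nonzero \<open>\<eta> \<in> E\<^sub>0V\<close>.
\<close>

definition TDD_canonical_map ::
    "('k::field, 'a) leonard_data \<Rightarrow> ('k, 'v) module \<Rightarrow> ('a \<Rightarrow> 'v \<Rightarrow> 'v) \<Rightarrow> 'v \<Rightarrow> 'a \<Rightarrow> 'k mat" where
  "TDD_canonical_map \<Phi> V act \<eta> X =
     (THE Y. represents V act (ls_d \<Phi>) (TDD_basis \<Phi> act \<eta>) Y X)"

end

theory Submission
  imports Defs "HOL-Algebra.RingHom"
begin

text \<open>
  Realise \<open>\<A>\<close> as matrices in a basis of eigenvectors of \<open>A\<^sup>*\<close>. Then \<open>E\<^sup>*\<^sub>i\<close> is the diagonal matrix unit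
  and \<open>A\<close> is irreducible tridiagonal, so the eigenspace of \<open>A\<close> for \<open>\<theta>\<^sub>0\<close> is a line. A spanning vector
  has no zero entry, because \<open>E\<^sup>*\<^sub>i E\<^sub>0 \<noteq> 0\<close>, and rescaling the basis turns it into the all ones vector,
  which says that all row sums of \<open>A\<close> are \<open>\<theta>\<^sub>0\<close>. Conversely, in a canonical form the tridiagonal shape
  of \<open>A\<close> and \<open>A\<^sup>*\<^sub>0\<^sub>0 = \<theta>\<^sup>*\<^sub>0\<close> force \<open>A\<^sup>* = diag(\<theta>\<^sup>*\<^sub>0, \<dots>, \<theta>\<^sup>*\<^sub>d)\<close>; the vectors \<open>E\<^sup>*\<^sub>i \<eta>\<close> are then a common
  multiple of the standard basis, so the isomorphism onto the matrix algebra can only be \<open>\<flat>\<close>.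
\<close>

section \<open>Isomorphisms onto matrix algebras\<close>

text \<open>Existence and uniqueness meet in one notion, \<open>TDD_representation\<close>: an
  isomorphism \<sigma> onto the matrix algebra under which \<open>Astar\<close> becomes diagonal in
  the prescribed order and \<open>A\<close> has row sums \<theta>_0. Every such \<sigma> yields a
  canonical form and every canonical form comes from one. For any admissible module V and vector
  \<eta> the canonical map computed from them agrees with \<sigma> on the carrier; uniqueness of
  \<sigma> follows by evaluating that map twice over one and the same module. Two obstacles shape
  the proof. The module V is abstract, so it is compared with K^(d+1) by an injection built from the
  algebra and \<eta> alone. And a canonical form fixes only entry 0 of the diagonal of
  \<open>Astar\<close>; the order of the others has to be recovered inductively. Eigenspaces are
  treated without dimension theory: an eigenvector of a matrix of the shape occurring here is
  determined by its entry 0.\<close>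

lemma k_algebra_ring: "k_algebra M \<Longrightarrow> ring M"
  by (simp add: k_algebra_def)

lemma k_algebra_smult_closed:
  "k_algebra M \<Longrightarrow> x \<in> carrier M \<Longrightarrow> c \<odot>\<^bsub>M\<^esub> x \<in> carrier M"
  using Module.module.smult_closed[of class_ring M c x] by (simp add: k_algebra_def)

lemma ring_Mat_alg: "ring (Mat_alg n :: ('k::field, 'k mat) module)"
  by (rule k_algebra_ring[OF k_algebra_Mat_alg])

text \<open>Subtraction in the record is addition of an inverse known only by its ring properties,
  so \<open>A - B\<close> is identified by adding \<open>B\<close> back and cancelling.\<close>

lemma a_minus_Mat_alg:
  fixes A B :: "'k::field mat"
  assumes "A \<in> carrier_mat n n" "B \<in> carrier_mat n n"
  shows "A \<ominus>\<^bsub>Mat_alg n\<^esub> B = A - B"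
proof -
  interpret R: ring "Mat_alg n :: ('k, 'k mat) module" by (rule ring_Mat_alg)
  have "A - B \<in> carrier (Mat_alg n)" "B \<in> carrier (Mat_alg n)"
    using assms by (auto simp: module_mat_simps)
  moreover have "A = (A - B) \<oplus>\<^bsub>Mat_alg n\<^esub> B"
    using assms by (auto simp: module_mat_simps)
  ultimately show ?thesis
    by (metis R.minus_eq R.a_assoc R.r_neg R.r_zero R.a_inv_closed)
qed

context
  fixes M :: "('k::field, 'a) module" and N :: "('k, 'b) module" and \<sigma>
  assumes M: "k_algebra M" and N: "k_algebra N" and \<sigma>: "\<sigma> \<in> alg_iso M N"
begin

lemma alg_iso_ring_hom: "\<sigma> \<in> Ring.ring_hom M N"
  and alg_iso_bij: "bij_betw \<sigma> (carrier M) (carrier N)"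
  and alg_iso_smult: "x \<in> carrier M \<Longrightarrow> \<sigma> (c \<odot>\<^bsub>M\<^esub> x) = c \<odot>\<^bsub>N\<^esub> \<sigma> x"
  using \<sigma> by (auto simp: alg_iso_def)

lemma alg_iso_closed: "x \<in> carrier M \<Longrightarrow> \<sigma> x \<in> carrier N"
  using alg_iso_bij by (auto simp: bij_betw_def)

lemma alg_iso_one: "\<sigma> \<one>\<^bsub>M\<^esub> = \<one>\<^bsub>N\<^esub>"
  by (rule ring_hom_one[OF alg_iso_ring_hom])

lemma alg_iso_mult: "x \<in> carrier M \<Longrightarrow> y \<in> carrier M \<Longrightarrow> \<sigma> (x \<otimes>\<^bsub>M\<^esub> y) = \<sigma> x \<otimes>\<^bsub>N\<^esub> \<sigma> y"
  by (rule ring_hom_mult[OF alg_iso_ring_hom])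

lemma alg_iso_add: "x \<in> carrier M \<Longrightarrow> y \<in> carrier M \<Longrightarrow> \<sigma> (x \<oplus>\<^bsub>M\<^esub> y) = \<sigma> x \<oplus>\<^bsub>N\<^esub> \<sigma> y"
  by (rule ring_hom_add[OF alg_iso_ring_hom])

lemma alg_iso_zero: "\<sigma> \<zero>\<^bsub>M\<^esub> = \<zero>\<^bsub>N\<^esub>"
  by (rule ring_hom_zero[OF alg_iso_ring_hom k_algebra_ring[OF M] k_algebra_ring[OF N]])

lemma alg_iso_inj: "x \<in> carrier M \<Longrightarrow> y \<in> carrier M \<Longrightarrow> \<sigma> x = \<sigma> y \<longleftrightarrow> x = y"
  using alg_iso_bij by (auto simp: bij_betw_def inj_on_def)

lemma alg_iso_surj: "y \<in> carrier N \<Longrightarrow> \<exists>x\<in>carrier M. \<sigma> x = y"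
  using alg_iso_bij by (metis bij_betw_imp_surj_on imageE)

lemma alg_iso_eq_zero: "x \<in> carrier M \<Longrightarrow> \<sigma> x = \<zero>\<^bsub>N\<^esub> \<longleftrightarrow> x = \<zero>\<^bsub>M\<^esub>"
  using alg_iso_inj[of x "\<zero>\<^bsub>M\<^esub>"] alg_iso_zero ring.ring_simprules(2)[OF k_algebra_ring[OF M]]
  by auto

lemma alg_iso_minus:
  assumes "x \<in> carrier M" "y \<in> carrier M"
  shows "\<sigma> (x \<ominus>\<^bsub>M\<^esub> y) = \<sigma> x \<ominus>\<^bsub>N\<^esub> \<sigma> y"
proof -
  interpret ring_hom_ring M N \<sigma>
    by (rule ring_hom_ringI2[OF k_algebra_ring[OF M] k_algebra_ring[OF N] alg_iso_ring_hom])
  show ?thesis using assms by (simp add: a_minus_def)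
qed

lemma alg_iso_inv: "inv_into (carrier M) \<sigma> \<in> alg_iso N M"
proof -
  interpret M: ring M by (rule k_algebra_ring[OF M])
  let ?\<tau> = "inv_into (carrier M) \<sigma>"
  have bij: "bij_betw ?\<tau> (carrier N) (carrier M)"
    by (rule bij_betw_inv_into[OF alg_iso_bij])
  have inv: "?\<tau> (\<sigma> x) = x" if "x \<in> carrier M" for x
    using bij_betw_inv_into_left[OF alg_iso_bij that] .
  have surj: "\<exists>x\<in>carrier M. \<sigma> x = y" if "y \<in> carrier N" for y by (rule alg_iso_surj[OF that])
  have "?\<tau> \<in> Ring.ring_hom N M"
  proof (rule ring_hom_memI)
    fix x y assume "x \<in> carrier N" "y \<in> carrier N"
    then obtain x' y' where *: "x' \<in> carrier M" "y' \<in> carrier M" "x = \<sigma> x'" "y = \<sigma> y'"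
      using surj by metis
    show "?\<tau> (x \<otimes>\<^bsub>N\<^esub> y) = ?\<tau> x \<otimes>\<^bsub>M\<^esub> ?\<tau> y" "?\<tau> (x \<oplus>\<^bsub>N\<^esub> y) = ?\<tau> x \<oplus>\<^bsub>M\<^esub> ?\<tau> y"
      using * by (simp_all add: inv flip: alg_iso_mult alg_iso_add)
  next
    show "?\<tau> x \<in> carrier M" if "x \<in> carrier N" for x using bij that by (auto simp: bij_betw_def)
    show "?\<tau> \<one>\<^bsub>N\<^esub> = \<one>\<^bsub>M\<^esub>" using inv[of "\<one>\<^bsub>M\<^esub>"] by (simp add: alg_iso_one)
  qed
  moreover have "?\<tau> (c \<odot>\<^bsub>N\<^esub> y) = c \<odot>\<^bsub>M\<^esub> ?\<tau> y" if y: "y \<in> carrier N" for c y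
  proof -
    obtain x where x: "x \<in> carrier M" "\<sigma> x = y" using surj[OF y] by blast
    then show ?thesis
      using inv[OF k_algebra_smult_closed[OF M x(1)]] inv[OF x(1)] by (auto simp: alg_iso_smult)
  qed
  ultimately show ?thesis using bij by (simp add: alg_iso_def)
qed

lemma primitive_idempotent_factor_closed:
  "X \<in> carrier M \<Longrightarrow> c \<odot>\<^bsub>M\<^esub> (X \<ominus>\<^bsub>M\<^esub> a \<odot>\<^bsub>M\<^esub> \<one>\<^bsub>M\<^esub>) \<in> carrier M"
proof -
  interpret M: ring M by (rule k_algebra_ring[OF M])
  show "X \<in> carrier M \<Longrightarrow> c \<odot>\<^bsub>M\<^esub> (X \<ominus>\<^bsub>M\<^esub> a \<odot>\<^bsub>M\<^esub> \<one>\<^bsub>M\<^esub>) \<in> carrier M"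
    by (intro k_algebra_smult_closed[OF M] M.minus_closed) auto
qed

lemma primitive_idempotent_hom:
  assumes X: "X \<in> carrier M"
  shows "primitive_idempotent M X \<theta>s i \<in> carrier M \<and>
    \<sigma> (primitive_idempotent M X \<theta>s i) = primitive_idempotent N (\<sigma> X) \<theta>s i"
proof -
  interpret M: ring M by (rule k_algebra_ring[OF M])
  let ?f = "\<lambda>j Y. (inverse (\<theta>s ! i - \<theta>s ! j) \<odot>\<^bsub>M\<^esub> (X \<ominus>\<^bsub>M\<^esub> \<theta>s ! j \<odot>\<^bsub>M\<^esub> \<one>\<^bsub>M\<^esub>)) \<otimes>\<^bsub>M\<^esub> Y"
  let ?g = "\<lambda>j Y. (inverse (\<theta>s ! i - \<theta>s ! j) \<odot>\<^bsub>N\<^esub> (\<sigma> X \<ominus>\<^bsub>N\<^esub> \<theta>s ! j \<odot>\<^bsub>N\<^esub> \<one>\<^bsub>N\<^esub>)) \<otimes>\<^bsub>N\<^esub> Y"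
  \<comment> \<open>Stated for an arbitrary list of indices so that induction applies. Closure is
    carried along because multiplicativity of \<sigma> is available on the carrier only.\<close>
  have "foldr ?f js \<one>\<^bsub>M\<^esub> \<in> carrier M \<and> \<sigma> (foldr ?f js \<one>\<^bsub>M\<^esub>) = foldr ?g js \<one>\<^bsub>N\<^esub>" for js
    by (induction js)
      (auto simp: X alg_iso_one alg_iso_mult alg_iso_smult alg_iso_minus k_algebra_smult_closed[OF M]
        primitive_idempotent_factor_closed)
  then show ?thesis unfolding primitive_idempotent_def by blast
qed

end

lemma alg_iso_comp:
  assumes "\<sigma> \<in> alg_iso M N" and "\<tau> \<in> alg_iso N L"
  shows "\<tau> \<circ> \<sigma> \<in> alg_iso M L"
proof -
  have "\<sigma> x \<in> carrier N" if "x \<in> carrier M" for x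
    using assms(1) that by (auto simp: alg_iso_def bij_betw_def)
  then show ?thesis
    using assms unfolding alg_iso_def by (auto intro!: ring_hom_trans bij_betw_trans)
qed

lemma conj_alg_iso:
  fixes P Q :: "'k::field mat"
  assumes P: "P \<in> carrier_mat n n" and Q: "Q \<in> carrier_mat n n"
    and PQ: "P * Q = 1\<^sub>m n" and QP: "Q * P = 1\<^sub>m n"
  shows "(\<lambda>X. Q * X * P) \<in> alg_iso (Mat_alg n) (Mat_alg n)"
proof -
  have cancel: "P * (Q * X) = X" "Q * (P * X) = X" if "X \<in> carrier_mat n n" for X
    using that P Q PQ QP by (simp_all flip: assoc_mult_mat[of _ n n _ n _ n])
  have "(\<lambda>X. Q * X * P) \<in> Ring.ring_hom (Mat_alg n) (Mat_alg n)"
    by (rule ring_hom_memI)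
      (use P Q in \<open>auto simp: module_mat_simps QP mult_add_distrib_mat add_mult_distrib_mat
        assoc_mult_mat[of _ n n _ n _ n] cancel mult_add_distrib_mat[of _ n n _ n]
        add_mult_distrib_mat[of _ n n _ _ n]\<close>)
  moreover have "bij_betw (\<lambda>X. Q * X * P) (carrier_mat n n) (carrier_mat n n)"
    by (rule bij_betw_byWitness[where f' = "\<lambda>X. P * X * Q"])
      (use P Q in \<open>auto simp: QP PQ assoc_mult_mat[of _ n n _ n _ n] cancel\<close>)
  ultimately show ?thesis using P Q
    by (auto simp: alg_iso_def module_mat_simps mult_smult_distrib[of _ n n _ n]
      mult_smult_assoc_mat[of _ n n _ n])
qed

lemma mult_col_eigenvector:
  fixes A F :: "'k::comm_ring_1 mat"
  assumes A: "A \<in> carrier_mat n n" and F: "F \<in> carrier_mat n n" and AF: "A * F = \<theta> \<cdot>\<^sub>m F" and j: "j < n"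
  shows "A *\<^sub>v col F j = \<theta> \<cdot>\<^sub>v col F j"
proof -
  have "A *\<^sub>v col F j = col (A * F) j" by (rule col_mult2[OF A F j, symmetric])
  also have "\<dots> = \<theta> \<cdot>\<^sub>v col F j" unfolding AF using F j by (intro eq_vecI) auto
  finally show ?thesis .
qed

text \<open>The right side does not mention \<sigma>, so eigenvalues do not depend on the matrix
  realisation. An eigenvector becomes an element of the algebra by repeating it in every column;
  conversely any nonzero column of \<open>\<sigma> Y\<close> is an eigenvector.\<close>

lemma eigenvalue_alg_iso_iff:
  assumes M: "k_algebra M" and \<sigma>: "\<sigma> \<in> alg_iso M (Mat_alg n)" and X: "X \<in> carrier M"
  shows "eigenvalue (\<sigma> X) \<theta> \<longleftrightarrow> (\<exists>Y\<in>carrier M. Y \<noteq> \<zero>\<^bsub>M\<^esub> \<and> X \<otimes>\<^bsub>M\<^esub> Y = \<theta> \<odot>\<^bsub>M\<^esub> Y)"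
proof -
  interpret M: ring M by (rule k_algebra_ring[OF M])
  note iso = M k_algebra_Mat_alg \<sigma>
  have sX: "\<sigma> X \<in> carrier_mat n n" using alg_iso_closed[OF iso X] by (simp add: module_mat_simps)
  show ?thesis
  proof
    assume "eigenvalue (\<sigma> X) \<theta>"
    then obtain v where v: "v \<in> carrier_vec n" "v \<noteq> 0\<^sub>v n" "\<sigma> X *\<^sub>v v = \<theta> \<cdot>\<^sub>v v"
      using sX by (auto simp: eigenvalue_def eigenvector_def)
    let ?Z = "mat n n (\<lambda>(i, j). v $ i)"
    obtain Y where Y: "Y \<in> carrier M" "\<sigma> Y = ?Z"
      using alg_iso_surj[OF iso, of ?Z] by (auto simp: module_mat_simps)
    obtain k where k: "k < n" "v $ k \<noteq> 0"
      using v by (metis (no_types, lifting) carrier_vecD eq_vecI index_zero_vec)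
    have "?Z $$ (k, k) \<noteq> 0\<^sub>m n n $$ (k, k)" using k by simp
    then have "\<sigma> Y \<noteq> 0\<^sub>m n n" using Y by metis
    then have "Y \<noteq> \<zero>\<^bsub>M\<^esub>" using alg_iso_zero[OF iso] by (auto simp: module_mat_simps)
    moreover have "\<sigma> X * ?Z = \<theta> \<cdot>\<^sub>m ?Z"
    proof (rule eq_matI)
      fix i j assume ij: "i < dim_row (\<theta> \<cdot>\<^sub>m ?Z)" "j < dim_col (\<theta> \<cdot>\<^sub>m ?Z)"
      have "col ?Z j = v" using ij v(1) by auto
      then show "(\<sigma> X * ?Z) $$ (i, j) = (\<theta> \<cdot>\<^sub>m ?Z) $$ (i, j)"
        using ij sX v(1) arg_cong[OF v(3), of "\<lambda>w. w $ i"] by auto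
    qed (use sX in auto)
    then have "\<sigma> (X \<otimes>\<^bsub>M\<^esub> Y) = \<sigma> (\<theta> \<odot>\<^bsub>M\<^esub> Y)"
      using X Y by (simp add: alg_iso_mult[OF iso] alg_iso_smult[OF iso] module_mat_simps)
    then have "X \<otimes>\<^bsub>M\<^esub> Y = \<theta> \<odot>\<^bsub>M\<^esub> Y"
      using X Y(1) by (simp add: alg_iso_inj[OF iso] k_algebra_smult_closed[OF M])
    ultimately show "\<exists>Y\<in>carrier M. Y \<noteq> \<zero>\<^bsub>M\<^esub> \<and> X \<otimes>\<^bsub>M\<^esub> Y = \<theta> \<odot>\<^bsub>M\<^esub> Y" using Y(1) by blast
  next
    assume "\<exists>Y\<in>carrier M. Y \<noteq> \<zero>\<^bsub>M\<^esub> \<and> X \<otimes>\<^bsub>M\<^esub> Y = \<theta> \<odot>\<^bsub>M\<^esub> Y"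
    then obtain Y where Y: "Y \<in> carrier M" "Y \<noteq> \<zero>\<^bsub>M\<^esub>" "X \<otimes>\<^bsub>M\<^esub> Y = \<theta> \<odot>\<^bsub>M\<^esub> Y" by blast
    have sY: "\<sigma> Y \<in> carrier_mat n n" using alg_iso_closed[OF iso Y(1)] by (simp add: module_mat_simps)
    have "\<sigma> Y \<noteq> 0\<^sub>m n n"
      using alg_iso_eq_zero[OF iso Y(1)] Y(2) by (simp add: module_mat_simps)
    then obtain i j where ij: "i < n" "j < n" "\<sigma> Y $$ (i, j) \<noteq> 0"
      using sY by (metis (no_types, lifting) carrier_matD eq_matI index_zero_mat)
    have eq: "\<sigma> X * \<sigma> Y = \<theta> \<cdot>\<^sub>m \<sigma> Y"
      using arg_cong[OF Y(3), of \<sigma>] X Y(1)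
      by (simp add: alg_iso_mult[OF iso] alg_iso_smult[OF iso] module_mat_simps)
    have "\<sigma> X *\<^sub>v col (\<sigma> Y) j = \<theta> \<cdot>\<^sub>v col (\<sigma> Y) j"
      by (rule mult_col_eigenvector[OF sX sY eq ij(2)])
    moreover have "col (\<sigma> Y) j \<noteq> 0\<^sub>v n"
      using ij sY by (metis (no_types, lifting) carrier_matD index_col index_zero_vec(1))
    ultimately show "eigenvalue (\<sigma> X) \<theta>"
      using sX sY by (auto simp: eigenvalue_def eigenvector_def intro!: exI[of _ "col (\<sigma> Y) j"])
  qed
qed

lemma alg_eigenvalue_iff:
  assumes "k_algebra M" "\<sigma> \<in> alg_iso M (Mat_alg n)" "X \<in> carrier M"
  shows "alg_eigenvalue M n X \<theta> \<longleftrightarrow> eigenvalue (\<sigma> X) \<theta>"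
  using assms eigenvalue_alg_iso_iff[OF assms(1) _ assms(3)] unfolding alg_eigenvalue_def by blast

lemma alg_iso_id: "(\<lambda>X. X) \<in> alg_iso M M"
  by (auto simp: alg_iso_def bij_betw_def inj_on_def intro: ring_hom_memI)

lemma alg_eigenvalue_alg_iso:
  assumes M: "k_algebra M" and N: "k_algebra N" and \<tau>: "\<tau> \<in> alg_iso M N"
    and X: "X \<in> carrier M" and ne: "alg_iso M (Mat_alg n) \<noteq> {}"
  shows "alg_eigenvalue N n (\<tau> X) \<theta> \<longleftrightarrow> alg_eigenvalue M n X \<theta>"
proof -
  obtain \<sigma> where \<sigma>: "\<sigma> \<in> alg_iso M (Mat_alg n)" using ne by blast
  let ?\<tau>' = "inv_into (carrier M) \<tau>"
  have "?\<tau>' (\<tau> X) = X"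
    using bij_betw_inv_into_left[OF alg_iso_bij[OF M N \<tau>] X] .
  moreover have "\<sigma> \<circ> ?\<tau>' \<in> alg_iso N (Mat_alg n)"
    by (rule alg_iso_comp[OF alg_iso_inv[OF M N \<tau>] \<sigma>])
  ultimately show ?thesis
    using alg_eigenvalue_iff[OF M \<sigma> X] alg_eigenvalue_iff[OF N, of "\<sigma> \<circ> ?\<tau>'" n "\<tau> X"]
      alg_iso_closed[OF M N \<tau> X] by simp
qed

lemma primitive_idempotent_closed:
  assumes M: "k_algebra M" and X: "X \<in> carrier M"
  shows "primitive_idempotent M X \<theta>s i \<in> carrier M"
  using primitive_idempotent_hom[OF M M alg_iso_id X] by blast

section \<open>Primitive idempotents and diagonalisation\<close>

lemma smult_mat_mult_vec:
  "A \<in> carrier_mat n m \<Longrightarrow> v \<in> carrier_vec m \<Longrightarrow> (c \<cdot>\<^sub>m A) *\<^sub>v v = c \<cdot>\<^sub>v (A *\<^sub>v v)"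
  for A :: "'k::comm_ring_1 mat"
  by (auto intro!: eq_vecI simp: scalar_prod_def sum_distrib_left mult.assoc)

text \<open>Lagrange interpolation: \<open>primitive_idempotent\<close> evaluates at
  \<open>B\<close> the polynomial that is 1 at \<open>\<theta>s ! i\<close> and 0 at the other
  listed values. On \<open>v\<close> the factor for \<open>j\<close> is the scalar (\<theta>_k -
  \<theta>_j) / (\<theta>_i - \<theta>_j). All factors are 1 if \<open>k = i\<close>; otherwise the
  factor for \<open>j = k\<close> vanishes.\<close>

lemma primitive_idempotent_mult_eigenvector:
  fixes B :: "'k::field mat"
  assumes B: "B \<in> carrier_mat n n" and v: "v \<in> carrier_vec n" and Bv: "B *\<^sub>v v = \<theta>s ! k \<cdot>\<^sub>v v"
    and \<theta>s: "distinct \<theta>s" and i: "i < length \<theta>s" and k: "k < length \<theta>s"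
  shows "primitive_idempotent (Mat_alg n) B \<theta>s i *\<^sub>v v = (if k = i then v else 0\<^sub>v n)"
proof -
  let ?c = "\<lambda>j. inverse (\<theta>s ! i - \<theta>s ! j)"
  let ?F = "\<lambda>j. ?c j \<cdot>\<^sub>m (B - \<theta>s ! j \<cdot>\<^sub>m 1\<^sub>m n)"
  let ?js = "filter (\<lambda>j. j \<noteq> i) [0..<length \<theta>s]"
  have F: "?F j \<in> carrier_mat n n" for j using B by auto
  have Fv: "?F j *\<^sub>v v = (?c j * (\<theta>s ! k - \<theta>s ! j)) \<cdot>\<^sub>v v" for j
  proof -
    have "(B - \<theta>s ! j \<cdot>\<^sub>m 1\<^sub>m n) *\<^sub>v v = (\<theta>s ! k - \<theta>s ! j) \<cdot>\<^sub>v v"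
      using B v Bv by (subst minus_mult_distrib_mat_vec) (auto simp: algebra_simps)
    moreover have "B - \<theta>s ! j \<cdot>\<^sub>m 1\<^sub>m n \<in> carrier_mat n n" by auto
    ultimately show ?thesis using v by (simp add: smult_mat_mult_vec[of _ n n] smult_smult_assoc)
  qed
  have prod: "foldr (\<lambda>j Y. ?F j * Y) js (1\<^sub>m n) \<in> carrier_mat n n \<and>
    foldr (\<lambda>j Y. ?F j * Y) js (1\<^sub>m n) *\<^sub>v v
      = prod_list (map (\<lambda>j. ?c j * (\<theta>s ! k - \<theta>s ! j)) js) \<cdot>\<^sub>v v" for js
  proof (induction js)
    case Nil then show ?case using v by simp
  next
    case (Cons j js)
    let ?Y = "foldr (\<lambda>j Y. ?F j * Y) js (1\<^sub>m n)"
    have Y: "?Y \<in> carrier_mat n n" using Cons by blast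
    have "(?F j * ?Y) *\<^sub>v v = ?F j *\<^sub>v (?Y *\<^sub>v v)"
      by (rule assoc_mult_mat_vec[OF F Y v])
    then show ?case using Cons F[of j] Y v Fv[of j]
      by (simp add: mult_mat_vec[OF F] smult_smult_assoc mult.commute)
  qed
  have eq: "primitive_idempotent (Mat_alg n) B \<theta>s i = foldr (\<lambda>j Y. ?F j * Y) ?js (1\<^sub>m n)"
    using B by (simp add: primitive_idempotent_def module_mat_simps a_minus_Mat_alg)
  have "prod_list (map (\<lambda>j. ?c j * (\<theta>s ! k - \<theta>s ! j)) ?js) = (if k = i then 1 else 0)"
  proof (cases "k = i")
    case True
    have "map (\<lambda>j. ?c j * (\<theta>s ! k - \<theta>s ! j)) ?js = map (\<lambda>_. 1) ?js"
      using True \<theta>s i by (auto simp: nth_eq_iff_index_eq)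
    then show ?thesis using True by (simp add: map_replicate_const)
  next
    case False
    then have "k \<in> set ?js" using k by simp
    then have "0 \<in> set (map (\<lambda>j. ?c j * (\<theta>s ! k - \<theta>s ! j)) ?js)"
      by (metis (no_types, lifting) diff_self image_eqI list.set_map mult_zero_right)
    then show ?thesis using False by (simp add: prod_list_zero_iff)
  qed
  then show ?thesis unfolding eq using prod v by auto
qed

lemma mult_mat_unit_vec:
  assumes "(A :: 'k::comm_ring_1 mat) \<in> carrier_mat n m" "k < m"
  shows "A *\<^sub>v unit_vec m k = col A k"
  using assms by (auto intro!: eq_vecI)

text \<open>The unit vectors are eigenvectors, so the interpolation values appear column by column.
  The diagonal \<open>b\<close> may list the eigenvalues in any order: the uniqueness proof uses
  this before the order of the diagonal is known.\<close>

lemma primitive_idempotent_mat_diag: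
  fixes b :: "nat \<Rightarrow> 'k::field"
  assumes b: "\<And>k. k < n \<Longrightarrow> b k \<in> set \<theta>s" and \<theta>s: "distinct \<theta>s" and i: "i < length \<theta>s"
  shows "primitive_idempotent (Mat_alg n) (mat_diag n b) \<theta>s i
    = mat_diag n (\<lambda>k. if b k = \<theta>s ! i then 1 else 0)" (is "?E = ?D")
proof -
  have E: "?E \<in> carrier_mat n n"
    using primitive_idempotent_closed[OF k_algebra_Mat_alg, of "mat_diag n b" n \<theta>s i]
    by (simp add: module_mat_simps)
  have "col ?E k = col ?D k" if k: "k < n" for k
  proof -
    obtain l where l: "l < length \<theta>s" "b k = \<theta>s ! l" using b[OF k] by (metis in_set_conv_nth)
    have "mat_diag n b *\<^sub>v unit_vec n k = \<theta>s ! l \<cdot>\<^sub>v unit_vec n k"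
      using k l by (subst mult_mat_unit_vec[of _ n]) (auto simp: mat_diag_def intro!: eq_vecI)
    then have "?E *\<^sub>v unit_vec n k = (if l = i then unit_vec n k else 0\<^sub>v n)"
      by (intro primitive_idempotent_mult_eigenvector) (use l i \<theta>s in auto)
    then show ?thesis
      using k l i \<theta>s E
      by (subst (asm) mult_mat_unit_vec[of _ n])
        (auto simp: mat_diag_def nth_eq_iff_index_eq intro!: eq_vecI)
  qed
  then show ?thesis using E by (intro mat_col_eqI) (auto simp: mat_diag_def)
qed

text \<open>The columns of \<open>P\<close> are eigenvectors. They are independent because the
  idempotents separate them: applying the one for \<open>\<theta>s ! i\<close> to
  \<open>P *\<^sub>v x\<close> leaves \<open>x $ i\<close> times column \<open>i\<close>.\<close>

lemma eigenvectors_distinct_invertible: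
  fixes B :: "'k::field mat"
  assumes B: "B \<in> carrier_mat n n" and \<theta>s: "distinct \<theta>s" "length \<theta>s = n"
    and ev: "\<And>\<theta>. \<theta> \<in> set \<theta>s \<Longrightarrow> eigenvalue B \<theta>"
  obtains P Q where "P \<in> carrier_mat n n" "Q \<in> carrier_mat n n" "P * Q = 1\<^sub>m n" "Q * P = 1\<^sub>m n"
    "Q * B * P = mat_diag n (\<lambda>i. \<theta>s ! i)"
proof -
  have "\<exists>v. v \<in> carrier_vec n \<and> v \<noteq> 0\<^sub>v n \<and> B *\<^sub>v v = \<theta>s ! i \<cdot>\<^sub>v v" if "i < n" for i
    using ev[of "\<theta>s ! i"] B that \<theta>s(2) by (auto simp: eigenvalue_def eigenvector_def)
  then obtain w where w: "\<And>i. i < n \<Longrightarrow> w i \<in> carrier_vec n" "\<And>i. i < n \<Longrightarrow> w i \<noteq> 0\<^sub>v n"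
      "\<And>i. i < n \<Longrightarrow> B *\<^sub>v w i = \<theta>s ! i \<cdot>\<^sub>v w i"
    by metis
  define P where "P = mat n n (\<lambda>(i, j). w j $ i)"
  have P: "P \<in> carrier_mat n n" by (simp add: P_def)
  have col: "col P j = w j" if "j < n" for j using that w(1)[OF that] by (auto simp: P_def)
  have idx: "P $$ (i, j) = w j $ i" if "i < n" "j < n" for i j using that by (simp add: P_def)
  have BP: "B * P = P * mat_diag n (\<lambda>i. \<theta>s ! i)"
  proof (rule mat_col_eqI)
    fix j assume "j < dim_col (P * mat_diag n (\<lambda>i. \<theta>s ! i))"
    then have j: "j < n" using P by (simp add: mat_diag_def)
    show "col (B * P) j = col (P * mat_diag n (\<lambda>i. \<theta>s ! i)) j"
      using j w(1,3)[OF j] B P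
      by (subst col_mult2[OF B P j])
        (auto simp: col mat_diag_mult_right[OF P] idx mult.commute intro!: eq_vecI)
  qed (use B P in \<open>auto simp: mat_diag_def\<close>)
  have "x = 0\<^sub>v n" if x: "x \<in> carrier_vec n" "P *\<^sub>v x = 0\<^sub>v n" for x
  proof (rule eq_vecI)
    fix i assume "i < dim_vec (0\<^sub>v n)"
    then have i: "i < n" by simp
    let ?E = "primitive_idempotent (Mat_alg n) B \<theta>s i"
    have E: "?E \<in> carrier_mat n n"
      using primitive_idempotent_closed[OF k_algebra_Mat_alg, of B n \<theta>s i] B
      by (simp add: module_mat_simps)
    have EP: "?E * P = mat n n (\<lambda>(r, j). if j = i then w i $ r else 0)"
    proof (rule mat_col_eqI)
      fix j assume "j < dim_col (mat n n (\<lambda>(r, j). if j = i then w i $ r else 0))"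
      then have j: "j < n" by simp
      have "?E *\<^sub>v w j = (if j = i then w j else 0\<^sub>v n)"
        using i j \<theta>s w B by (intro primitive_idempotent_mult_eigenvector) auto
      then show "col (?E * P) j = col (mat n n (\<lambda>(r, j). if j = i then w i $ r else 0)) j"
        using j w(1)[OF i] by (subst col_mult2[OF E P j]) (auto simp: col intro!: eq_vecI)
    qed (use E P in auto)
    have "0\<^sub>v n = ?E *\<^sub>v (P *\<^sub>v x)" using E x by auto
    also have "\<dots> = (?E * P) *\<^sub>v x" using E P x by simp
    finally have 0: "(?E * P) *\<^sub>v x = 0\<^sub>v n" by simp
    obtain r where r: "r < n" "w i $ r \<noteq> 0"
      using w(1,2)[OF i] by (metis (no_types, lifting) carrier_vecD eq_vecI index_zero_vec)
    have "0 = ((?E * P) *\<^sub>v x) $ r" using 0 r by simp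
    also have "\<dots> = (\<Sum>j\<in>{0..<n}. (if j = i then w i $ r else 0) * x $ j)"
      using r x(1) by (simp add: EP scalar_prod_def)
    also have "\<dots> = (\<Sum>j\<in>{0..<n}. if j = i then w i $ r * x $ j else 0)"
      by (rule sum.cong) auto
    also have "\<dots> = w i $ r * x $ i" using i by simp
    finally show "x $ i = 0\<^sub>v n $ i" using r i by simp
  qed (use x in auto)
  then have "det P \<noteq> 0" using det_0_iff_vec_prod_zero_field[OF P] by blast
  then obtain Q where Q: "Q \<in> carrier_mat n n" "Q * P = 1\<^sub>m n" "P * Q = 1\<^sub>m n"
    using det_non_zero_imp_unit[OF P, of "()"]
    by (auto simp: Units_def ring_mat_def)
  have "Q * B * P = Q * (P * mat_diag n (\<lambda>i. \<theta>s ! i))"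
    using Q(1) P B BP by (simp add: assoc_mult_mat[of _ n n _ n _ n])
  also have "\<dots> = mat_diag n (\<lambda>i. \<theta>s ! i)"
    using Q P left_mult_one_mat[OF mat_diag_dim] by (simp flip: assoc_mult_mat[of _ n n _ n _ n])
  finally show ?thesis using that P Q by blast
qed

text \<open>The equation for row \<open>i\<close> determines the entry \<open>i + 1\<close> of the eigenvector from the earlier ones.\<close>

lemma lower_hessenberg_eigenvector_zero:
  fixes B :: "'k::field mat"
  assumes B: "B \<in> carrier_mat n n"
    and zero: "\<And>i j. i < n \<Longrightarrow> j < n \<Longrightarrow> Suc i < j \<Longrightarrow> B $$ (i, j) = 0"
    and nz: "\<And>i. Suc i < n \<Longrightarrow> B $$ (i, Suc i) \<noteq> 0"
    and x: "x \<in> carrier_vec n" and ev: "B *\<^sub>v x = \<theta> \<cdot>\<^sub>v x" and x0: "x $ 0 = 0"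
  shows "x = 0\<^sub>v n"
proof (rule eq_vecI)
  have "x $ k = 0" if "k < n" for k
    using that
  proof (induction k rule: less_induct)
    case (less k)
    show ?case
    proof (cases k)
      case 0 then show ?thesis using x0 by simp
    next
      case (Suc i)
      then have i: "i < n" "Suc i < n" using less by auto
      have "0 = (B *\<^sub>v x) $ i" using ev less Suc i x by simp
      also have "\<dots> = (\<Sum>j\<in>{0..<n}. B $$ (i, j) * x $ j)"
        using i B x by (simp add: scalar_prod_def)
      also have "\<dots> = (\<Sum>j\<in>{0..<n}. if j = Suc i then B $$ (i, j) * x $ j else 0)"
      proof (rule sum.cong)
        fix j assume j: "j \<in> {0..<n}"
        consider "j < Suc i" | "j = Suc i" | "Suc i < j" by linarith
        then show "B $$ (i, j) * x $ j = (if j = Suc i then B $$ (i, j) * x $ j else 0)"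
          by cases (use less.IH[of j] zero[of i j] j i Suc in auto)
      qed simp
      also have "\<dots> = B $$ (i, Suc i) * x $ Suc i" using i by simp
      finally show ?thesis using nz[OF i(2)] Suc by simp
    qed
  qed
  then show "x $ k = 0\<^sub>v n $ k" if "k < dim_vec (0\<^sub>v n)" for k using that by simp
qed (use x in auto)

text \<open>Subtracting from \<open>x\<close> the multiple of \<open>y\<close> with the same entry 0
  leaves a solution of the eigenvector equation whose entry 0 vanishes, so nothing is left.\<close>

lemma lower_hessenberg_eigenvector_multiple:
  fixes B :: "'k::field mat"
  assumes B: "B \<in> carrier_mat n n" and n: "0 < n"
    and zero: "\<And>i j. i < n \<Longrightarrow> j < n \<Longrightarrow> Suc i < j \<Longrightarrow> B $$ (i, j) = 0"
    and nz: "\<And>i. Suc i < n \<Longrightarrow> B $$ (i, Suc i) \<noteq> 0"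
    and x: "x \<in> carrier_vec n" "B *\<^sub>v x = \<theta> \<cdot>\<^sub>v x"
    and y: "y \<in> carrier_vec n" "B *\<^sub>v y = \<theta> \<cdot>\<^sub>v y" "y $ 0 \<noteq> 0"
  shows "x = (x $ 0 / y $ 0) \<cdot>\<^sub>v y"
proof -
  let ?c = "x $ 0 / y $ 0"
  have "x - ?c \<cdot>\<^sub>v y = 0\<^sub>v n"
  proof (rule lower_hessenberg_eigenvector_zero[OF B zero nz])
    have "B *\<^sub>v (x - ?c \<cdot>\<^sub>v y) = B *\<^sub>v x - ?c \<cdot>\<^sub>v (B *\<^sub>v y)"
      using x y B by (simp add: mult_minus_distrib_mat_vec mult_mat_vec)
    also have "\<dots> = \<theta> \<cdot>\<^sub>v (x - ?c \<cdot>\<^sub>v y)"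
      using x y by (auto intro!: eq_vecI simp: algebra_simps)
    finally show "B *\<^sub>v (x - ?c \<cdot>\<^sub>v y) = \<theta> \<cdot>\<^sub>v (x - ?c \<cdot>\<^sub>v y)" .
  qed (use x y n in auto)
  then have 0: "(x - ?c \<cdot>\<^sub>v y) $ i = 0" if "i < n" for i using that by simp
  show ?thesis
  proof (rule eq_vecI)
    fix i assume "i < dim_vec (?c \<cdot>\<^sub>v y)"
    then have i: "i < n" using y(1) by simp
    have "(x - ?c \<cdot>\<^sub>v y) $ i = x $ i - (?c \<cdot>\<^sub>v y) $ i"
      using i y(1) by (simp only: carrier_vecD index_minus_vec index_smult_vec)
    with 0[OF i] show "x $ i = (?c \<cdot>\<^sub>v y) $ i" by (simp only: right_minus_eq)
  qed (use x(1) y(1) in simp)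
qed

section \<open>Transport of Leonard systems\<close>

text \<open>An equivalence because both directions occur: the sequences of \<Phi> pass to its image,
  and those of a given canonical form are pulled back to \<Phi>. The second direction rests on
  injectivity of the isomorphism on the listed idempotents.\<close>

lemma eigenvalue_order_alg_iso_iff:
  assumes M: "k_algebra M" and N: "k_algebra N" and \<sigma>: "\<sigma> \<in> alg_iso M N" and X: "X \<in> carrier M"
    and ne: "alg_iso M (Mat_alg (Suc d)) \<noteq> {}" and Es: "set Es \<subseteq> carrier M"
  shows "eigenvalue_order N d (\<sigma> X) (map \<sigma> Es) \<theta>s \<longleftrightarrow> eigenvalue_order M d X Es \<theta>s"
proof -
  let ?Es = "map (primitive_idempotent M X \<theta>s) [0..<Suc d]"
  have eq: "map (primitive_idempotent N (\<sigma> X) \<theta>s) [0..<Suc d] = map \<sigma> ?Es"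
    using primitive_idempotent_hom[OF M N \<sigma> X] by simp
  have "set ?Es \<subseteq> carrier M" using primitive_idempotent_closed[OF M X] by auto
  then have "inj_on \<sigma> (set Es \<union> set ?Es)"
    using alg_iso_bij[OF M N \<sigma>] Es by (meson Un_least bij_betw_def inj_on_subset)
  then have "map \<sigma> Es = map \<sigma> ?Es \<longleftrightarrow> Es = ?Es" by (rule inj_on_map_eq_map)
  then show ?thesis
    unfolding eigenvalue_order_def eq alg_eigenvalue_alg_iso[OF M N \<sigma> X ne] by simp
qed

lemma eigenvalue_order_closed:
  "k_algebra M \<Longrightarrow> X \<in> carrier M \<Longrightarrow> eigenvalue_order M d X Es \<theta>s \<Longrightarrow> set Es \<subseteq> carrier M"
  by (auto simp: eigenvalue_order_def primitive_idempotent_closed)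

lemma eigenvalue_order_length: "eigenvalue_order M d X Es \<theta>s \<Longrightarrow> length Es = Suc d"
  by (simp add: eigenvalue_order_def)

lemma eigenvalue_order_nth_closed:
  "k_algebra M \<Longrightarrow> X \<in> carrier M \<Longrightarrow> eigenvalue_order M d X Es \<theta>s \<Longrightarrow> i \<le> d \<Longrightarrow> Es ! i \<in> carrier M"
  using eigenvalue_order_closed eigenvalue_order_length by (metis le_imp_less_Suc nth_mem subsetD)

lemma idempotent_sequence_alg_iso:
  assumes M: "k_algebra M" and N: "k_algebra N" and \<sigma>: "\<sigma> \<in> alg_iso M N"
    and X: "X \<in> carrier M" and Y: "Y \<in> carrier M"
    and ne: "alg_iso M (Mat_alg (Suc d)) \<noteq> {}" and seq: "idempotent_sequence M d X Y Es"
  shows "idempotent_sequence N d (\<sigma> X) (\<sigma> Y) (map \<sigma> Es)"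
proof -
  interpret M: ring M by (rule k_algebra_ring[OF M])
  obtain \<theta>s where \<theta>s: "eigenvalue_order M d X Es \<theta>s"
    using seq by (auto simp: idempotent_sequence_def)
  note cl = eigenvalue_order_nth_closed[OF M X \<theta>s] and len = eigenvalue_order_length[OF \<theta>s]
  have "map \<sigma> Es ! i \<otimes>\<^bsub>N\<^esub> \<sigma> Y \<otimes>\<^bsub>N\<^esub> map \<sigma> Es ! j = \<zero>\<^bsub>N\<^esub> \<longleftrightarrow>
      Es ! i \<otimes>\<^bsub>M\<^esub> Y \<otimes>\<^bsub>M\<^esub> Es ! j = \<zero>\<^bsub>M\<^esub>" if "i \<le> d" "j \<le> d" for i j
    using that cl Y alg_iso_eq_zero[OF M N \<sigma>, of "Es ! i \<otimes>\<^bsub>M\<^esub> Y \<otimes>\<^bsub>M\<^esub> Es ! j"]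
    by (simp add: len alg_iso_mult[OF M N \<sigma>])
  moreover have "eigenvalue_order N d (\<sigma> X) (map \<sigma> Es) \<theta>s"
    using \<theta>s eigenvalue_order_alg_iso_iff[OF M N \<sigma> X ne eigenvalue_order_closed[OF M X \<theta>s]] by simp
  ultimately show ?thesis using seq by (auto simp: idempotent_sequence_def)
qed

lemma multiplicity_free_alg_iso:
  assumes M: "k_algebra M" and N: "k_algebra N" and \<sigma>: "\<sigma> \<in> alg_iso M N"
    and ne: "alg_iso M (Mat_alg (Suc d)) \<noteq> {}" and X: "multiplicity_free M d X"
  shows "multiplicity_free N d (\<sigma> X)"
proof -
  have "X \<in> carrier M" using X by (simp add: multiplicity_free_def)
  then show ?thesis
    using X alg_eigenvalue_alg_iso[OF M N \<sigma> _ ne] alg_iso_closed[OF M N \<sigma>]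
    by (simp add: multiplicity_free_def)
qed

lemma leonard_system_map_system:
  assumes \<Phi>: "leonard_system \<Phi>" and N: "k_algebra N" and \<sigma>: "\<sigma> \<in> alg_iso (ls_alg \<Phi>) N"
  shows "leonard_system (map_system N \<sigma> \<Phi>)"
proof -
  have M: "k_algebra (ls_alg \<Phi>)" and ne: "alg_iso (ls_alg \<Phi>) (Mat_alg (Suc (ls_d \<Phi>))) \<noteq> {}"
    using \<Phi> by (auto simp: leonard_system_def)
  have "alg_iso N (Mat_alg (Suc (ls_d \<Phi>))) \<noteq> {}"
    using ne alg_iso_comp[OF alg_iso_inv[OF M N \<sigma>]] by blast
  then show ?thesis
    using \<Phi> N multiplicity_free_alg_iso[OF M N \<sigma> ne] idempotent_sequence_alg_iso[OF M N \<sigma> _ _ ne]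
    by (auto simp: leonard_system_def map_system_def multiplicity_free_def)
qed

section \<open>Matrix coordinates in an eigenbasis\<close>

lemma mat_diag_mult_both:
  fixes A :: "'k::field mat"
  assumes A: "A \<in> carrier_mat n n"
  shows "mat_diag n f * A * mat_diag n g = mat n n (\<lambda>(i, j). f i * A $$ (i, j) * g j)"
proof -
  have "mat_diag n f * A \<in> carrier_mat n n" using A by (metis mat_diag_dim mult_carrier_mat)
  then show ?thesis
    by (subst mat_diag_mult_right[of _ n]) (auto simp: mat_diag_mult_left[OF A])
qed

text \<open>Beyond \<open>tridiagonal_mat\<close>, the two diagonals next to the main one are free
  of zeros. This allows eigenvector equations to be solved from entry 0 onwards, for the matrix as
  well as for its transpose.\<close>

definition irreducible_tridiagonal :: "nat \<Rightarrow> 'k::zero mat \<Rightarrow> bool" where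
  "irreducible_tridiagonal n B \<longleftrightarrow>
     (\<forall>i<n. \<forall>j<n. (Suc i < j \<or> Suc j < i \<longrightarrow> B $$ (i, j) = 0) \<and>
       (j = Suc i \<or> i = Suc j \<longrightarrow> B $$ (i, j) \<noteq> 0))"

context
  fixes M :: "('k::field, 'a) module" and d :: nat and X :: 'a and Es :: "'a list" and \<theta>s :: "'k list"
  assumes M: "k_algebra M" and X: "X \<in> carrier M" and order: "eigenvalue_order M d X Es \<theta>s"
begin

text \<open>Any realisation followed by conjugation with a matrix of eigenvectors. \<open>X\<close>
  will be \<open>A\<close> when the product of \<open>Estar ! i\<close> and \<open>E ! 0\<close> is
  shown to be nonzero, and \<open>Astar\<close> when the canonical form is built.\<close>

lemma diagonalizing_alg_iso_exists:
  assumes "alg_iso M (Mat_alg (Suc d)) \<noteq> {}"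
  shows "\<exists>\<sigma>\<in>alg_iso M (Mat_alg (Suc d)). \<sigma> X = mat_diag (Suc d) (\<lambda>i. \<theta>s ! i)"
proof -
  let ?n = "Suc d"
  obtain \<sigma> where \<sigma>: "\<sigma> \<in> alg_iso M (Mat_alg ?n)" using assms by blast
  have \<sigma>X: "\<sigma> X \<in> carrier_mat ?n ?n"
    using alg_iso_closed[OF M k_algebra_Mat_alg \<sigma> X] by (simp add: module_mat_simps)
  have ev: "eigenvalue (\<sigma> X) \<theta>" if "\<theta> \<in> set \<theta>s" for \<theta>
    using that order alg_eigenvalue_iff[OF M \<sigma> X] by (simp add: eigenvalue_order_def)
  have \<theta>s: "distinct \<theta>s" "length \<theta>s = ?n" using order by (auto simp: eigenvalue_order_def)
  obtain P Q where PQ: "P \<in> carrier_mat ?n ?n" "Q \<in> carrier_mat ?n ?n" "P * Q = 1\<^sub>m ?n"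
      "Q * P = 1\<^sub>m ?n" "Q * \<sigma> X * P = mat_diag ?n (\<lambda>i. \<theta>s ! i)"
    using eigenvectors_distinct_invertible[OF \<sigma>X \<theta>s ev] by blast
  have "(\<lambda>Z. Q * Z * P) \<circ> \<sigma> \<in> alg_iso M (Mat_alg ?n)"
    by (rule alg_iso_comp[OF \<sigma> conj_alg_iso]) (use PQ in auto)
  then show ?thesis using PQ(5) by (intro bexI[of _ "(\<lambda>Z. Q * Z * P) \<circ> \<sigma>"]) auto
qed

lemma alg_iso_primitive_idempotent_diag:
  assumes \<sigma>: "\<sigma> \<in> alg_iso M (Mat_alg (Suc d))" and diag: "\<sigma> X = mat_diag (Suc d) b"
    and b: "\<And>k. k \<le> d \<Longrightarrow> b k \<in> set \<theta>s" and i: "i \<le> d"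
  shows "\<sigma> (Es ! i) = mat_diag (Suc d) (\<lambda>k. if b k = \<theta>s ! i then 1 else 0)"
proof -
  have "Es ! i = primitive_idempotent M X \<theta>s i"
    using order i unfolding eigenvalue_order_def by (metis diff_zero add_0 le_imp_less_Suc length_upt nth_map nth_upt)
  then have "\<sigma> (Es ! i) = primitive_idempotent (Mat_alg (Suc d)) (mat_diag (Suc d) b) \<theta>s i"
    using primitive_idempotent_hom[OF M k_algebra_Mat_alg \<sigma> X] diag by metis
  then show ?thesis
    using order i b by (simp add: primitive_idempotent_mat_diag eigenvalue_order_def)
qed

lemma alg_iso_primitive_idempotent:
  assumes \<sigma>: "\<sigma> \<in> alg_iso M (Mat_alg (Suc d))" and diag: "\<sigma> X = mat_diag (Suc d) (\<lambda>i. \<theta>s ! i)"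
    and i: "i \<le> d"
  shows "\<sigma> (Es ! i) = mat_diag (Suc d) (\<lambda>k. if k = i then 1 else 0)"
proof -
  have "\<sigma> (Es ! i) = mat_diag (Suc d) (\<lambda>k. if \<theta>s ! k = \<theta>s ! i then 1 else 0)"
    by (rule alg_iso_primitive_idempotent_diag[OF \<sigma> diag _ i])
      (use order in \<open>auto simp: eigenvalue_order_def\<close>)
  also have "\<dots> = mat_diag (Suc d) (\<lambda>k. if k = i then 1 else 0)"
    using order i by (auto simp: mat_diag_def eigenvalue_order_def nth_eq_iff_index_eq intro!: eq_matI)
  finally show ?thesis .
qed

text \<open>In a realisation where \<open>X\<close> is diagonal these are facts about diagonal
  matrices, pulled back along the injective \<sigma>. The first equation makes the columns of an
  idempotent eigenvectors, the second makes its rows left eigenvectors.\<close>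

lemma primitive_idempotent_eigen:
  assumes ne: "alg_iso M (Mat_alg (Suc d)) \<noteq> {}" and i: "i \<le> d"
  shows "X \<otimes>\<^bsub>M\<^esub> Es ! i = \<theta>s ! i \<odot>\<^bsub>M\<^esub> Es ! i" and "Es ! i \<otimes>\<^bsub>M\<^esub> X = \<theta>s ! i \<odot>\<^bsub>M\<^esub> Es ! i"
    and "Es ! i \<noteq> \<zero>\<^bsub>M\<^esub>"
proof -
  interpret M: ring M by (rule k_algebra_ring[OF M])
  obtain \<sigma> where \<sigma>: "\<sigma> \<in> alg_iso M (Mat_alg (Suc d))" "\<sigma> X = mat_diag (Suc d) (\<lambda>i. \<theta>s ! i)"
    using diagonalizing_alg_iso_exists[OF ne] by blast
  note iso = M k_algebra_Mat_alg \<sigma>(1)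
  note E = alg_iso_primitive_idempotent[OF \<sigma> i] and cl = eigenvalue_order_nth_closed[OF M X order i]
  have scalar: "mat_diag (Suc d) (\<lambda>k. f k * (if k = i then 1 else 0)) =
      f i \<cdot>\<^sub>m mat_diag (Suc d) (\<lambda>k. if k = i then 1 else 0)" for f :: "nat \<Rightarrow> 'k"
    by (auto simp: mat_diag_def)
  show "X \<otimes>\<^bsub>M\<^esub> Es ! i = \<theta>s ! i \<odot>\<^bsub>M\<^esub> Es ! i"
    using cl X E \<sigma>(2)
    by (subst alg_iso_inj[OF iso, symmetric])
      (auto simp: alg_iso_mult[OF iso] alg_iso_smult[OF iso] k_algebra_smult_closed[OF M]
        module_mat_simps scalar)
  show "Es ! i \<otimes>\<^bsub>M\<^esub> X = \<theta>s ! i \<odot>\<^bsub>M\<^esub> Es ! i"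
    using cl X E \<sigma>(2)
    by (subst alg_iso_inj[OF iso, symmetric])
      (auto simp: alg_iso_mult[OF iso] alg_iso_smult[OF iso] k_algebra_smult_closed[OF M]
        module_mat_simps scalar[of "(!) \<theta>s"] mult.commute[of _ "\<theta>s ! _"])
  have "\<sigma> (Es ! i) $$ (i, i) = 1" unfolding E using i by (simp add: mat_diag_def)
  then have "\<sigma> (Es ! i) \<noteq> 0\<^sub>m (Suc d) (Suc d)" using i by auto
  then show "Es ! i \<noteq> \<zero>\<^bsub>M\<^esub>" using alg_iso_zero[OF iso] by (auto simp: module_mat_simps)
qed

text \<open>Under \<sigma> each \<open>Es ! i\<close> is the diagonal matrix unit at
  \<open>i\<close>, so sandwiching \<open>Y\<close> between \<open>Es ! i\<close> and
  \<open>Es ! j\<close> keeps just the entry \<open>(i, j)\<close> of \<open>\<sigma> Y\<close>. The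
  conditions on products become conditions on single entries.\<close>

lemma idempotent_sequence_irreducible_tridiagonal:
  assumes \<sigma>: "\<sigma> \<in> alg_iso M (Mat_alg (Suc d))" "\<sigma> X = mat_diag (Suc d) (\<lambda>i. \<theta>s ! i)"
    and Y: "Y \<in> carrier M" and seq: "idempotent_sequence M d X Y Es"
  shows "irreducible_tridiagonal (Suc d) (\<sigma> Y)"
proof -
  interpret M: ring M by (rule k_algebra_ring[OF M])
  note iso = M k_algebra_Mat_alg \<sigma>(1)
  have \<sigma>Y: "\<sigma> Y \<in> carrier_mat (Suc d) (Suc d)"
    using alg_iso_closed[OF iso Y] by (simp add: module_mat_simps)
  have key: "Es ! i \<otimes>\<^bsub>M\<^esub> Y \<otimes>\<^bsub>M\<^esub> Es ! j = \<zero>\<^bsub>M\<^esub> \<longleftrightarrow> \<sigma> Y $$ (i, j) = 0"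
    if ij: "i \<le> d" "j \<le> d" for i j
  proof -
    note cl = eigenvalue_order_nth_closed[OF M X order]
    have "\<sigma> (Es ! i \<otimes>\<^bsub>M\<^esub> Y \<otimes>\<^bsub>M\<^esub> Es ! j) =
        mat (Suc d) (Suc d) (\<lambda>(r, c). (if r = i then 1 else 0) * \<sigma> Y $$ (r, c) * (if c = j then 1 else 0))"
      using ij cl Y \<sigma>Y
      by (simp add: alg_iso_mult[OF iso] alg_iso_primitive_idempotent[OF \<sigma>] module_mat_simps
          mat_diag_mult_both)
    also have "\<dots> = 0\<^sub>m (Suc d) (Suc d) \<longleftrightarrow> \<sigma> Y $$ (i, j) = 0" (is "?Z = _ \<longleftrightarrow> _")
    proof
      assume "?Z = 0\<^sub>m (Suc d) (Suc d)"
      from arg_cong[OF this, of "\<lambda>Z. Z $$ (i, j)"] show "\<sigma> Y $$ (i, j) = 0" using ij by simp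
    qed (auto intro!: eq_matI)
    finally show ?thesis
      using alg_iso_eq_zero[OF iso, of "Es ! i \<otimes>\<^bsub>M\<^esub> Y \<otimes>\<^bsub>M\<^esub> Es ! j"] cl ij Y
      by (simp add: module_mat_simps)
  qed
  have seq': "(\<bar>int i - int j\<bar> > 1 \<longrightarrow> \<sigma> Y $$ (i, j) = 0) \<and> (\<bar>int i - int j\<bar> = 1 \<longrightarrow> \<sigma> Y $$ (i, j) \<noteq> 0)"
    if "i \<le> d" "j \<le> d" for i j
  proof -
    have "(\<bar>int i - int j\<bar> > 1 \<longrightarrow> Es ! i \<otimes>\<^bsub>M\<^esub> Y \<otimes>\<^bsub>M\<^esub> Es ! j = \<zero>\<^bsub>M\<^esub>) \<and>
        (\<bar>int i - int j\<bar> = 1 \<longrightarrow> Es ! i \<otimes>\<^bsub>M\<^esub> Y \<otimes>\<^bsub>M\<^esub> Es ! j \<noteq> \<zero>\<^bsub>M\<^esub>)"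
      using seq that unfolding idempotent_sequence_def by blast
    then show ?thesis unfolding key[OF that] .
  qed
  show ?thesis
    unfolding irreducible_tridiagonal_def
  proof (intro allI impI conjI)
    fix i j assume ij: "i < Suc d" "j < Suc d"
    show "\<sigma> Y $$ (i, j) = 0" if "Suc i < j \<or> Suc j < i"
      using seq'[of i j] ij that by auto
    show "\<sigma> Y $$ (i, j) \<noteq> 0" if "j = Suc i \<or> i = Suc j"
      using seq'[of i j] ij that by auto
  qed
qed

end

lemma irreducible_tridiagonal_zero:
  "irreducible_tridiagonal n B \<Longrightarrow> i < n \<Longrightarrow> j < n \<Longrightarrow> Suc i < j \<or> Suc j < i \<Longrightarrow> B $$ (i, j) = 0"
  and irreducible_tridiagonal_super: "irreducible_tridiagonal n B \<Longrightarrow> Suc i < n \<Longrightarrow> B $$ (i, Suc i) \<noteq> 0"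
  and irreducible_tridiagonal_sub: "irreducible_tridiagonal n B \<Longrightarrow> Suc i < n \<Longrightarrow> B $$ (Suc i, i) \<noteq> 0"
  unfolding irreducible_tridiagonal_def by (blast dest: Suc_lessD)+

section \<open>Existence of the canonical form\<close>

locale leonard =
  fixes \<Phi> :: "('k::field, 'a) leonard_data"
  assumes leonard_system: "leonard_system \<Phi>"
begin

abbreviation "M \<equiv> ls_alg \<Phi>"
abbreviation "d \<equiv> ls_d \<Phi>"
abbreviation "A \<equiv> ls_A \<Phi>"
abbreviation "Astar \<equiv> ls_Astar \<Phi>"
abbreviation "E \<equiv> ls_E \<Phi>"
abbreviation "Estar \<equiv> ls_Estar \<Phi>"

lemma M: "k_algebra M"
  and iso_Mat: "alg_iso M (Mat_alg (Suc d)) \<noteq> {}"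
  and A_closed: "A \<in> carrier M"
  and Astar_closed: "Astar \<in> carrier M"
  and E_sequence: "idempotent_sequence M d A Astar E"
  and Estar_sequence: "idempotent_sequence M d Astar A Estar"
  using leonard_system by (auto simp: leonard_system_def multiplicity_free_def)

lemma eigenvalue_sequence_exists: "\<exists>\<theta>s. eigenvalue_sequence \<Phi> \<theta>s"
  and dual_eigenvalue_sequence_exists: "\<exists>\<theta>s. dual_eigenvalue_sequence \<Phi> \<theta>s"
  using E_sequence Estar_sequence
  by (auto simp: idempotent_sequence_def eigenvalue_sequence_def dual_eigenvalue_sequence_def)

lemma E_subset: "set E \<subseteq> carrier M"
  using eigenvalue_sequence_exists eigenvalue_order_closed[OF M A_closed]
  unfolding eigenvalue_sequence_def by blast

lemma Estar_subset: "set Estar \<subseteq> carrier M"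
  using dual_eigenvalue_sequence_exists eigenvalue_order_closed[OF M Astar_closed]
  unfolding dual_eigenvalue_sequence_def by blast

lemma E_closed: "i \<le> d \<Longrightarrow> E ! i \<in> carrier M"
  using eigenvalue_sequence_exists eigenvalue_order_nth_closed[OF M A_closed]
  by (auto simp: eigenvalue_sequence_def)

lemma Estar_closed: "i \<le> d \<Longrightarrow> Estar ! i \<in> carrier M"
  using dual_eigenvalue_sequence_exists eigenvalue_order_nth_closed[OF M Astar_closed]
  by (auto simp: dual_eigenvalue_sequence_def)

text \<open>In an eigenbasis of \<open>A\<close>, a row of \<open>E\<^sup>*\<^sub>i\<close> is a left eigenvector of the irreducible tridiagonal
  matrix of \<open>A\<^sup>*\<close>, so it vanishes as soon as its entry \<open>0\<close> does.\<close>

lemma Estar_mult_E0_nonzero: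
  assumes i: "i \<le> d"
  shows "Estar ! i \<otimes>\<^bsub>M\<^esub> E ! 0 \<noteq> \<zero>\<^bsub>M\<^esub>"
proof
  assume 0: "Estar ! i \<otimes>\<^bsub>M\<^esub> E ! 0 = \<zero>\<^bsub>M\<^esub>"
  let ?n = "Suc d"
  obtain \<theta>s \<theta>s' where \<theta>s: "eigenvalue_order M d A E \<theta>s" and \<theta>s': "eigenvalue_order M d Astar Estar \<theta>s'"
    using eigenvalue_sequence_exists dual_eigenvalue_sequence_exists
    by (auto simp: eigenvalue_sequence_def dual_eigenvalue_sequence_def)
  obtain \<sigma> where \<sigma>: "\<sigma> \<in> alg_iso M (Mat_alg ?n)" "\<sigma> A = mat_diag ?n (\<lambda>i. \<theta>s ! i)"
    using diagonalizing_alg_iso_exists[OF M A_closed \<theta>s iso_Mat] by blast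
  note iso = M k_algebra_Mat_alg \<sigma>(1)
  let ?B = "\<sigma> Astar" and ?F = "\<sigma> (Estar ! i)"
  have B: "?B \<in> carrier_mat ?n ?n" and F: "?F \<in> carrier_mat ?n ?n"
    using alg_iso_closed[OF iso] Astar_closed Estar_closed[OF i] by (auto simp: module_mat_simps)
  have tri: "irreducible_tridiagonal ?n ?B"
    by (rule idempotent_sequence_irreducible_tridiagonal[OF M A_closed \<theta>s \<sigma> Astar_closed E_sequence])
  have FB: "?F * ?B = \<theta>s' ! i \<cdot>\<^sub>m ?F"
    using arg_cong[OF primitive_idempotent_eigen(2)[OF M Astar_closed \<theta>s' iso_Mat i], of \<sigma>]
      Astar_closed Estar_closed[OF i]
    by (simp add: alg_iso_mult[OF iso] alg_iso_smult[OF iso] module_mat_simps)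
  \<comment> \<open>\<open>E ! 0\<close> is the matrix unit at \<open>(0, 0)\<close>, so right
    multiplication by it keeps column 0 of \<open>?F\<close> alone; the assumption says that this
    column is zero.\<close>
  have "?F * mat_diag ?n (\<lambda>k. if k = 0 then 1 else 0) = 0\<^sub>m ?n ?n"
    using arg_cong[OF 0, of \<sigma>] Estar_closed[OF i] E_closed[of 0]
    by (simp add: alg_iso_mult[OF iso] alg_iso_zero[OF iso] module_mat_simps
        alg_iso_primitive_idempotent[OF M A_closed \<theta>s \<sigma>])
  then have FD: "mat ?n ?n (\<lambda>(r, k). ?F $$ (r, k) * (if k = 0 then 1 else 0)) = 0\<^sub>m ?n ?n"
    by (simp only: mat_diag_mult_right[OF F])
  have F0: "?F $$ (r, 0) = 0" if "r < ?n" for r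
    using arg_cong[OF FD, of "\<lambda>Z. Z $$ (r, 0)"] that by simp
  have row: "row ?F r = 0\<^sub>v ?n" if r: "r < ?n" for r
  proof (rule lower_hessenberg_eigenvector_zero[of "?B\<^sup>T"])
    show "?B\<^sup>T *\<^sub>v row ?F r = \<theta>s' ! i \<cdot>\<^sub>v row ?F r"
    proof (rule eq_vecI)
      fix c assume "c < dim_vec (\<theta>s' ! i \<cdot>\<^sub>v row ?F r)"
      then have c: "c < ?n" using F by simp
      have "(?B\<^sup>T *\<^sub>v row ?F r) $ c = (?F * ?B) $$ (r, c)"
        using c r F B by (simp add: comm_scalar_prod[of _ ?n])
      then show "(?B\<^sup>T *\<^sub>v row ?F r) $ c = (\<theta>s' ! i \<cdot>\<^sub>v row ?F r) $ c"
        using FB F c r by simp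
    qed (use B F in simp)
  qed (use B F r F0[OF r] irreducible_tridiagonal_zero[OF tri] irreducible_tridiagonal_sub[OF tri] in auto)
  have "?F = 0\<^sub>m ?n ?n"
    using F row by (intro eq_rowI) auto
  then show False
    using primitive_idempotent_eigen(3)[OF M Astar_closed \<theta>s' iso_Mat i]
      alg_iso_eq_zero[OF iso Estar_closed[OF i]] by (simp add: module_mat_simps)
qed

text \<open>The ordered diagonal of \<open>\<sigma> Astar\<close> fixes the basis up to a factor for
  each vector and already makes \<open>\<sigma> A\<close> irreducible tridiagonal. The row sums
  reduce the freedom to one common factor, which conjugation does not see.\<close>

definition TDD_representation :: "('a \<Rightarrow> 'k mat) \<Rightarrow> 'k list \<Rightarrow> 'k list \<Rightarrow> bool" where
  "TDD_representation \<sigma> \<theta>s \<theta>s' \<longleftrightarrow>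
     \<sigma> \<in> alg_iso M (Mat_alg (Suc d)) \<and> eigenvalue_sequence \<Phi> \<theta>s \<and> dual_eigenvalue_sequence \<Phi> \<theta>s' \<and>
     \<sigma> Astar = mat_diag (Suc d) (\<lambda>i. \<theta>s' ! i) \<and> (\<forall>i\<le>d. (\<Sum>j\<le>d. \<sigma> A $$ (i, j)) = \<theta>s ! 0)"

lemma TDD_representation_exists: "\<exists>\<sigma> \<theta>s \<theta>s'. TDD_representation \<sigma> \<theta>s \<theta>s'"
proof -
  let ?n = "Suc d"
  obtain \<theta>s \<theta>s' where seq: "eigenvalue_sequence \<Phi> \<theta>s" "dual_eigenvalue_sequence \<Phi> \<theta>s'"
    using eigenvalue_sequence_exists dual_eigenvalue_sequence_exists by blast
  then have \<theta>s: "eigenvalue_order M d A E \<theta>s" and \<theta>s': "eigenvalue_order M d Astar Estar \<theta>s'"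
    by (auto simp: eigenvalue_sequence_def dual_eigenvalue_sequence_def)
  obtain \<sigma> where \<sigma>: "\<sigma> \<in> alg_iso M (Mat_alg ?n)" "\<sigma> Astar = mat_diag ?n (\<lambda>i. \<theta>s' ! i)"
    using diagonalizing_alg_iso_exists[OF M Astar_closed \<theta>s' iso_Mat] by blast
  note iso = M k_algebra_Mat_alg \<sigma>(1)
  let ?B = "\<sigma> A" and ?F = "\<sigma> (E ! 0)"
  have B: "?B \<in> carrier_mat ?n ?n" and F: "?F \<in> carrier_mat ?n ?n"
    using alg_iso_closed[OF iso] A_closed E_closed[of 0] by (auto simp: module_mat_simps)
  have tri: "irreducible_tridiagonal ?n ?B"
    by (rule idempotent_sequence_irreducible_tridiagonal[OF M Astar_closed \<theta>s' \<sigma> A_closed Estar_sequence])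
  have BF: "?B * ?F = \<theta>s ! 0 \<cdot>\<^sub>m ?F"
    using arg_cong[OF primitive_idempotent_eigen(1)[OF M A_closed \<theta>s iso_Mat, of 0], of \<sigma>]
      A_closed E_closed[of 0]
    by (simp add: alg_iso_mult[OF iso] alg_iso_smult[OF iso] module_mat_simps)
  have col: "?B *\<^sub>v col ?F c = \<theta>s ! 0 \<cdot>\<^sub>v col ?F c" if "c < ?n" for c
    by (rule mult_col_eigenvector[OF B F BF that])
  \<comment> \<open>Left multiplication by the matrix unit for \<open>Estar ! i\<close> keeps row
    \<open>i\<close> of \<open>?F\<close>, so a zero row would make the product of
    \<open>Estar ! i\<close> and \<open>E ! 0\<close> vanish.\<close>
  have row: "\<exists>c<?n. ?F $$ (i, c) \<noteq> 0" if i: "i < ?n" for i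
  proof (rule ccontr)
    assume "\<not> ?thesis"
    then have "mat_diag ?n (\<lambda>k. if k = i then 1 else 0) * ?F = 0\<^sub>m ?n ?n"
      by (auto simp: mat_diag_mult_left[OF F] intro!: eq_matI)
    then have "\<sigma> (Estar ! i \<otimes>\<^bsub>M\<^esub> E ! 0) = \<sigma> \<zero>\<^bsub>M\<^esub>"
      using i Estar_closed[of i] E_closed[of 0]
      by (simp add: alg_iso_mult[OF iso] alg_iso_zero[OF iso] module_mat_simps
        alg_iso_primitive_idempotent[OF M Astar_closed \<theta>s' \<sigma>])
    moreover have "Estar ! i \<otimes>\<^bsub>M\<^esub> E ! 0 \<in> carrier M"
      using i Estar_closed[of i] E_closed[of 0] ring.ring_simprules(5)[OF k_algebra_ring[OF M]] by simp
    ultimately show False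
      using Estar_mult_E0_nonzero[of i] i alg_iso_eq_zero[OF iso] alg_iso_zero[OF iso] by auto
  qed
  \<comment> \<open>Column \<open>c\<close> has a nonzero entry 0, so every column of
    \<open>?F\<close> is a multiple of it. A zero entry of \<open>y\<close> would therefore give
    \<open>?F\<close> a zero row.\<close>
  obtain c where c: "c < ?n" "?F $$ (0, c) \<noteq> 0" using row[of 0] by auto
  define y where "y = col ?F c"
  have y: "y \<in> carrier_vec ?n" "?B *\<^sub>v y = \<theta>s ! 0 \<cdot>\<^sub>v y" "y $ 0 \<noteq> 0"
    using c F col[OF c(1)] by (auto simp: y_def)
  have y_nz: "y $ i \<noteq> 0" if i: "i < ?n" for i
  proof
    assume 0: "y $ i = 0"
    obtain c' where c': "c' < ?n" "?F $$ (i, c') \<noteq> 0" using row[OF i] by blast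
    have "col ?F c' = (col ?F c' $ 0 / y $ 0) \<cdot>\<^sub>v y"
      by (rule lower_hessenberg_eigenvector_multiple[OF B _ _ _ _ col[OF c'(1)] y])
        (use F c'(1) irreducible_tridiagonal_zero[OF tri] irreducible_tridiagonal_super[OF tri] in auto)
    from arg_cong[OF this, of "\<lambda>v. v $ i"] show False using c' i F y(1) 0 by simp
  qed
  \<comment> \<open>Scaling basis vector \<open>i\<close> by \<open>y $ i\<close> turns the
    coordinates of \<open>y\<close> into all ones and leaves the diagonal matrix of
    \<open>Astar\<close> unchanged. Row sum \<open>i\<close> of the new matrix of \<open>A\<close>
    is entry \<open>i\<close> of \<open>?B *\<^sub>v y\<close> divided by
    \<open>y $ i\<close>.\<close>
  let ?P = "mat_diag ?n (\<lambda>i. y $ i)" and ?Q = "mat_diag ?n (\<lambda>i. inverse (y $ i))"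
  have PQ: "?P * ?Q = 1\<^sub>m ?n" "?Q * ?P = 1\<^sub>m ?n"
    using y_nz unfolding mat_diag_diag by (auto simp: mat_diag_def one_mat_def intro!: eq_matI)
  let ?\<tau> = "(\<lambda>Z. ?Q * Z * ?P) \<circ> \<sigma>"
  have "?\<tau> \<in> alg_iso M (Mat_alg ?n)"
    by (rule alg_iso_comp[OF \<sigma>(1) conj_alg_iso]) (use PQ in auto)
  moreover have "?\<tau> Astar = mat_diag ?n (\<lambda>i. \<theta>s' ! i)"
    using y_nz unfolding comp_apply \<sigma>(2) mat_diag_diag by (auto simp: mat_diag_def intro!: eq_matI)
  moreover have "(\<Sum>j\<le>d. ?\<tau> A $$ (i, j)) = \<theta>s ! 0" if i: "i \<le> d" for i
  proof -
    have "(\<Sum>j\<le>d. ?\<tau> A $$ (i, j)) = (\<Sum>j\<le>d. inverse (y $ i) * (?B $$ (i, j) * y $ j))"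
      using i by (intro sum.cong) (auto simp: mat_diag_mult_both[OF B] mult.assoc)
    also have "\<dots> = inverse (y $ i) * (\<Sum>j\<in>{0..<?n}. ?B $$ (i, j) * y $ j)"
      by (simp only: sum_distrib_left atLeast0LessThan lessThan_Suc_atMost)
    also have "(\<Sum>j\<in>{0..<?n}. ?B $$ (i, j) * y $ j) = (?B *\<^sub>v y) $ i"
      using i B y(1) by (simp add: scalar_prod_def del: sum.op_ivl_Suc)
    also have "\<dots> = \<theta>s ! 0 * y $ i" using i y by simp
    finally show ?thesis using y_nz[of i] i by simp
  qed
  ultimately show ?thesis using seq unfolding TDD_representation_def by blast
qed

section \<open>From representations to canonical forms\<close>

context
  fixes \<sigma> \<theta>s \<theta>s'
  assumes rep: "TDD_representation \<sigma> \<theta>s \<theta>s'"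
begin

lemma TDD_representation_iso: "\<sigma> \<in> alg_iso M (Mat_alg (Suc d))"
  and TDD_representation_order: "eigenvalue_order M d A E \<theta>s"
  and TDD_representation_dual_order: "eigenvalue_order M d Astar Estar \<theta>s'"
  and TDD_representation_Astar: "\<sigma> Astar = mat_diag (Suc d) (\<lambda>i. \<theta>s' ! i)"
  and TDD_representation_row_sum: "i \<le> d \<Longrightarrow> (\<Sum>j\<le>d. \<sigma> A $$ (i, j)) = \<theta>s ! 0"
  using rep
  by (auto simp: TDD_representation_def eigenvalue_sequence_def dual_eigenvalue_sequence_def)

lemma TDD_representation_A_closed: "\<sigma> A \<in> carrier_mat (Suc d) (Suc d)"
  using alg_iso_closed[OF M k_algebra_Mat_alg TDD_representation_iso A_closed]
  by (simp add: module_mat_simps)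

lemma TDD_representation_tridiagonal: "irreducible_tridiagonal (Suc d) (\<sigma> A)"
  by (rule idempotent_sequence_irreducible_tridiagonal[OF M Astar_closed TDD_representation_dual_order
    TDD_representation_iso TDD_representation_Astar A_closed Estar_sequence])

lemma TDD_representation_canonical_form:
  "TDD_canonical_form_for \<Phi> (map_system (Mat_alg (Suc d)) \<sigma> \<Phi>)" (is "TDD_canonical_form_for \<Phi> ?\<Psi>")
proof -
  note iso = M k_algebra_Mat_alg TDD_representation_iso
  have "leonard_system ?\<Psi>"
    by (rule leonard_system_map_system[OF leonard_system k_algebra_Mat_alg TDD_representation_iso])
  moreover have "isomorphic_systems \<Phi> ?\<Psi>"
    using TDD_representation_iso by (auto simp: isomorphic_systems_def map_system_def)
  moreover have "tridiagonal_mat (ls_A ?\<Psi>)"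
    using TDD_representation_tridiagonal TDD_representation_A_closed
    unfolding tridiagonal_mat_def irreducible_tridiagonal_def map_system_def
    by simp (metis less_antisym not_less_eq)
  moreover have "diagonal_mat (ls_Astar ?\<Psi>)"
    by (auto simp: map_system_def TDD_representation_Astar diagonal_mat_def mat_diag_def)
  moreover have "eigenvalue_sequence ?\<Psi> \<theta>s"
    using TDD_representation_order eigenvalue_order_closed[OF M A_closed]
      eigenvalue_order_alg_iso_iff[OF iso A_closed iso_Mat]
    by (auto simp: eigenvalue_sequence_def map_system_def)
  moreover have "dual_eigenvalue_sequence ?\<Psi> \<theta>s'"
    using TDD_representation_dual_order eigenvalue_order_closed[OF M Astar_closed]
      eigenvalue_order_alg_iso_iff[OF iso Astar_closed iso_Mat]
    by (auto simp: dual_eigenvalue_sequence_def map_system_def)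
  moreover have "ls_Astar ?\<Psi> $$ (0, 0) = \<theta>s' ! 0"
    by (simp add: map_system_def TDD_representation_Astar mat_diag_def)
  moreover have "\<forall>i\<le>d. (\<Sum>j\<le>d. ls_A ?\<Psi> $$ (i, j)) = \<theta>s ! 0"
    using TDD_representation_row_sum by (simp add: map_system_def)
  ultimately show ?thesis
    unfolding TDD_canonical_form_for_def in_TDD_canonical_form_def
    by (auto simp: map_system_def)
qed

end

end

section \<open>The canonical map and uniqueness\<close>

text \<open>A copy of K^n inside the matrix algebra, as a left ideal. Through it vectors can act on
  a module of which only the action of the algebra is known.\<close>

definition first_col_mat :: "nat \<Rightarrow> 'k::field vec \<Rightarrow> 'k mat" where
  "first_col_mat n x = mat n n (\<lambda>(i, j). if j = 0 then x $ i else 0)"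

lemma first_col_mat_carrier [simp]: "first_col_mat n x \<in> carrier_mat n n"
  by (simp add: first_col_mat_def)

lemma mult_first_col_mat:
  assumes "B \<in> carrier_mat n n" "x \<in> carrier_vec n"
  shows "B * first_col_mat n x = first_col_mat n (B *\<^sub>v x)"
  using assms by (auto simp: first_col_mat_def scalar_prod_def intro!: eq_matI)

text \<open>The outer product of \<open>x\<close> and row 0 of \<open>B\<close>. With all ones for
  \<open>x\<close> it reproduces every matrix whose rows are all equal.\<close>

lemma first_col_mat_mult:
  assumes "B \<in> carrier_mat n n"
  shows "first_col_mat n x * B = mat n n (\<lambda>(i, j). x $ i * B $$ (0, j))"
proof (rule eq_matI)
  fix i j assume "i < dim_row (mat n n (\<lambda>(i, j). x $ i * B $$ (0, j)))"
    "j < dim_col (mat n n (\<lambda>(i, j). x $ i * B $$ (0, j)))"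
  then have ij: "i < n" "j < n" by auto
  then have "(first_col_mat n x * B) $$ (i, j) = (\<Sum>k\<in>{0..<n}. (if k = 0 then x $ i else 0) * B $$ (k, j))"
    using assms by (simp add: first_col_mat_def scalar_prod_def)
  also have "\<dots> = (\<Sum>k\<in>{0..<n}. if k = 0 then x $ i * B $$ (k, j) else 0)"
    by (rule sum.cong) auto
  also have "\<dots> = x $ i * B $$ (0, j)" using ij by simp
  finally show "(first_col_mat n x * B) $$ (i, j) = mat n n (\<lambda>(i, j). x $ i * B $$ (0, j)) $$ (i, j)"
    using ij by simp
qed (use assms in \<open>auto simp: first_col_mat_def\<close>)

text \<open>Irreducibility of K^n in concrete form; it makes the map from K^(d+1) into an abstract
  module injective.\<close>

lemma mult_mat_vec_transitive:
  assumes x: "(x :: 'k::field vec) \<in> carrier_vec n" "x \<noteq> 0\<^sub>v n" and y: "y \<in> carrier_vec n"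
  shows "\<exists>B\<in>carrier_mat n n. B *\<^sub>v x = y"
proof -
  obtain k where k: "k < n" "x $ k \<noteq> 0"
    using x by (metis (no_types, lifting) carrier_vecD eq_vecI index_zero_vec)
  let ?B = "mat n n (\<lambda>(i, j). if j = k then y $ i / x $ k else 0)"
  have "?B *\<^sub>v x = y"
  proof (rule eq_vecI)
    fix i assume i: "i < dim_vec y"
    then have "(?B *\<^sub>v x) $ i = (\<Sum>j\<in>{0..<n}. (if j = k then y $ i / x $ k else 0) * x $ j)"
      using x y by (auto simp: scalar_prod_def)
    also have "\<dots> = (\<Sum>j\<in>{0..<n}. if j = k then y $ i else 0)"
      using k by (intro sum.cong) auto
    also have "\<dots> = y $ i" using k by simp
    finally show "(?B *\<^sub>v x) $ i = y $ i" .
  qed (use y in auto)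
  then show ?thesis by (intro bexI[of _ ?B]) auto
qed

text \<open>A system contains only images of carrier elements, and the canonical map is compared
  with an isomorphism only there.\<close>

lemma map_system_cong:
  assumes "leonard_system \<Phi>" and eq: "\<And>X. X \<in> carrier (ls_alg \<Phi>) \<Longrightarrow> \<sigma> X = \<tau> X"
  shows "map_system N \<sigma> \<Phi> = map_system N \<tau> \<Phi>"
proof -
  interpret leonard \<Phi> by (rule leonard.intro[OF assms(1)])
  show ?thesis
    using eq E_subset Estar_subset A_closed Astar_closed by (auto simp: map_system_def)
qed

section \<open>The canonical map computed from a representation\<close>

context leonard
begin

context
  fixes \<sigma> \<theta>s \<theta>s'
  assumes rep: "TDD_representation \<sigma> \<theta>s \<theta>s'"
begin

abbreviation (input) "ones \<equiv> vec (Suc d) (\<lambda>_. 1 :: 'k)"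

lemma TDD_representation_ones: "\<sigma> A *\<^sub>v ones = \<theta>s ! 0 \<cdot>\<^sub>v ones"
proof (rule eq_vecI)
  fix i assume "i < dim_vec (\<theta>s ! 0 \<cdot>\<^sub>v ones)"
  then have i: "i \<le> d" by simp
  then have "(\<sigma> A *\<^sub>v ones) $ i = (\<Sum>j\<in>{0..<Suc d}. \<sigma> A $$ (i, j))"
    using TDD_representation_A_closed[OF rep] by (simp add: scalar_prod_def del: sum.op_ivl_Suc)
  also have "\<dots> = \<theta>s ! 0"
    using TDD_representation_row_sum[OF rep i] by (simp only: atLeast0LessThan lessThan_Suc_atMost)
  finally show "(\<sigma> A *\<^sub>v ones) $ i = (\<theta>s ! 0 \<cdot>\<^sub>v ones) $ i" using i by simp
qed (use TDD_representation_A_closed[OF rep] in auto)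

text \<open>The row sums make the all ones vector an eigenvector for \<theta>_0, and the
  interpolation idempotent of \<theta>_0 fixes it. This qualifies it as \<eta> in the concrete
  module K^(d+1).\<close>

lemma TDD_representation_E0_ones: "\<sigma> (E ! 0) *\<^sub>v ones = ones"
proof -
  note order = TDD_representation_order[OF rep]
  have "E ! 0 = primitive_idempotent M A \<theta>s 0"
    using order by (auto simp: eigenvalue_order_def nth_append)
  then have "\<sigma> (E ! 0) = primitive_idempotent (Mat_alg (Suc d)) (\<sigma> A) \<theta>s 0"
    using primitive_idempotent_hom[OF M k_algebra_Mat_alg TDD_representation_iso[OF rep] A_closed]
    by simp
  moreover have "primitive_idempotent (Mat_alg (Suc d)) (\<sigma> A) \<theta>s 0 *\<^sub>v ones = (if 0 = (0::nat) then ones else 0\<^sub>v (Suc d))"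
    by (rule primitive_idempotent_mult_eigenvector[OF TDD_representation_A_closed[OF rep] _ TDD_representation_ones])
      (use order in \<open>auto simp: eigenvalue_order_def\<close>)
  ultimately show ?thesis by simp
qed

text \<open>Each column is a solution of the eigenvector equation of \<open>\<sigma> A\<close> for
  \<theta>_0. Such solutions are determined by their entry 0, and the all ones vector is one of
  them.\<close>

lemma TDD_representation_E0_columns:
  assumes "i \<le> d" "j \<le> d"
  shows "\<sigma> (E ! 0) $$ (i, j) = \<sigma> (E ! 0) $$ (0, j)"
proof -
  let ?n = "Suc d"
  note iso = M k_algebra_Mat_alg TDD_representation_iso[OF rep]
  note tri = TDD_representation_tridiagonal[OF rep]
  let ?B = "\<sigma> A" and ?F = "\<sigma> (E ! 0)"
  have B: "?B \<in> carrier_mat ?n ?n" and F: "?F \<in> carrier_mat ?n ?n"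
    using alg_iso_closed[OF iso] A_closed E_closed[of 0] by (auto simp: module_mat_simps)
  have BF: "?B * ?F = \<theta>s ! 0 \<cdot>\<^sub>m ?F"
    using arg_cong[OF primitive_idempotent_eigen(1)[OF M A_closed TDD_representation_order[OF rep] iso_Mat, of 0], of \<sigma>]
      A_closed E_closed[of 0]
    by (simp add: alg_iso_mult[OF iso] alg_iso_smult[OF iso] module_mat_simps)
  have col: "?B *\<^sub>v col ?F j = \<theta>s ! 0 \<cdot>\<^sub>v col ?F j"
    by (rule mult_col_eigenvector[OF B F BF]) (use assms in simp)
  have "col ?F j = (col ?F j $ 0 / ones $ 0) \<cdot>\<^sub>v ones"
    by (rule lower_hessenberg_eigenvector_multiple[OF B _ _ _ _ col _ TDD_representation_ones])
      (use F assms irreducible_tridiagonal_zero[OF tri] irreducible_tridiagonal_super[OF tri]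
        in \<open>auto intro: carrier_vecI\<close>)
  from arg_cong[OF this, of "\<lambda>v. v $ i"] show ?thesis using assms F by simp
qed

text \<open>The columns of \<open>\<sigma>(E\<^sub>0)\<close> are multiples of the all ones vector, so \<open>E\<^sub>0\<close> factors through the left
  ideal of matrices supported in column \<open>0\<close>, which is \<open>K\<^bsup>d+1\<^esup>\<close> as a module; this ideal acts on
  \<open>\<eta>\<close>.\<close>

lemma TDD_representation_embedding:
  assumes V: "left_alg_module M V act"
    and \<eta>: "\<eta> \<in> act (E ! 0) ` carrier V" "\<eta> \<noteq> \<zero>\<^bsub>V\<^esub>"
  obtains \<phi> where "\<And>x. x \<in> carrier_vec (Suc d) \<Longrightarrow> \<phi> x \<in> carrier V"
    and "\<And>x y. x \<in> carrier_vec (Suc d) \<Longrightarrow> y \<in> carrier_vec (Suc d) \<Longrightarrow> \<phi> (x + y) = \<phi> x \<oplus>\<^bsub>V\<^esub> \<phi> y"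
    and "\<And>c x. x \<in> carrier_vec (Suc d) \<Longrightarrow> \<phi> (c \<cdot>\<^sub>v x) = c \<odot>\<^bsub>V\<^esub> \<phi> x"
    and "\<And>X x. X \<in> carrier M \<Longrightarrow> x \<in> carrier_vec (Suc d) \<Longrightarrow> act X (\<phi> x) = \<phi> (\<sigma> X *\<^sub>v x)"
    and "inj_on \<phi> (carrier_vec (Suc d))"
    and "\<phi> ones = \<eta>"
proof -
  interpret L: left_alg_module M V act by (rule V)
  let ?n = "Suc d"
  note iso = M k_algebra_Mat_alg TDD_representation_iso[OF rep]
  define \<tau> where "\<tau> = inv_into (carrier M) \<sigma>"
  have \<tau>: "\<tau> \<in> alg_iso (Mat_alg ?n) M" unfolding \<tau>_def by (rule alg_iso_inv[OF iso])
  note iso' = k_algebra_Mat_alg M \<tau>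
  have \<tau>_closed: "\<tau> B \<in> carrier M" if "B \<in> carrier_mat ?n ?n" for B
    using alg_iso_closed[OF iso'] that by (simp add: module_mat_simps)
  have \<tau>_mult: "\<tau> (B * C) = \<tau> B \<otimes>\<^bsub>M\<^esub> \<tau> C" if "B \<in> carrier_mat ?n ?n" "C \<in> carrier_mat ?n ?n" for B C
    using alg_iso_mult[OF iso'] that by (simp add: module_mat_simps)
  have \<tau>_add: "\<tau> (B + C) = \<tau> B \<oplus>\<^bsub>M\<^esub> \<tau> C" if "B \<in> carrier_mat ?n ?n" "C \<in> carrier_mat ?n ?n" for B C
    using alg_iso_add[OF iso'] that by (simp add: module_mat_simps)
  have \<tau>_smult: "\<tau> (c \<cdot>\<^sub>m B) = c \<odot>\<^bsub>M\<^esub> \<tau> B" if "B \<in> carrier_mat ?n ?n" for c B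
    using alg_iso_smult[OF iso'] that by (simp add: module_mat_simps)
  have \<tau>_\<sigma>: "\<tau> (\<sigma> X) = X" if "X \<in> carrier M" for X
    unfolding \<tau>_def by (rule bij_betw_inv_into_left[OF alg_iso_bij[OF iso] that])
  have \<sigma>_closed: "\<sigma> X \<in> carrier_mat ?n ?n" if "X \<in> carrier M" for X
    using alg_iso_closed[OF iso that] by (simp add: module_mat_simps)
  let ?F = "\<sigma> (E ! 0)"
  have F: "?F \<in> carrier_mat ?n ?n" by (rule \<sigma>_closed[OF E_closed]) simp
  obtain v where v: "v \<in> carrier V" "\<eta> = act (E ! 0) v" using \<eta>(1) by blast
  have \<eta>_closed: "\<eta> \<in> carrier V" unfolding v(2) by (rule L.act_closed[OF E_closed v(1)]) simp
  define \<phi> where "\<phi> = (\<lambda>x. act (\<tau> (first_col_mat ?n x)) \<eta>)"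
  have closed: "\<phi> x \<in> carrier V" for x
    unfolding \<phi>_def by (rule L.act_closed[OF \<tau>_closed \<eta>_closed]) simp
  have add: "\<phi> (x + y) = \<phi> x \<oplus>\<^bsub>V\<^esub> \<phi> y" if "x \<in> carrier_vec ?n" "y \<in> carrier_vec ?n" for x y
  proof -
    have "first_col_mat ?n (x + y) = first_col_mat ?n x + first_col_mat ?n y"
      using that by (auto simp: first_col_mat_def intro!: eq_matI)
    then show ?thesis unfolding \<phi>_def by (simp add: \<tau>_add L.act_add_left \<tau>_closed \<eta>_closed)
  qed
  have smult: "\<phi> (c \<cdot>\<^sub>v x) = c \<odot>\<^bsub>V\<^esub> \<phi> x" if "x \<in> carrier_vec ?n" for c x
  proof -
    have "first_col_mat ?n (c \<cdot>\<^sub>v x) = c \<cdot>\<^sub>m first_col_mat ?n x"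
      using that by (auto simp: first_col_mat_def intro!: eq_matI)
    then show ?thesis unfolding \<phi>_def by (simp add: \<tau>_smult L.act_smult_left \<tau>_closed \<eta>_closed)
  qed
  have act: "act X (\<phi> x) = \<phi> (\<sigma> X *\<^sub>v x)" if X: "X \<in> carrier M" and x: "x \<in> carrier_vec ?n" for X x
  proof -
    have "act X (\<phi> x) = act (\<tau> (\<sigma> X) \<otimes>\<^bsub>M\<^esub> \<tau> (first_col_mat ?n x)) \<eta>"
      unfolding \<phi>_def \<tau>_\<sigma>[OF X] by (rule L.act_mult[symmetric]) (use X \<tau>_closed \<eta>_closed in auto)
    also have "\<dots> = \<phi> (\<sigma> X *\<^sub>v x)"
      unfolding \<phi>_def
      by (simp add: \<tau>_mult[symmetric] \<sigma>_closed[OF X] mult_first_col_mat[OF \<sigma>_closed[OF X] x])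
    finally show ?thesis .
  qed
  \<comment> \<open>As the rows of \<open>?F\<close> agree, it is the outer product of all ones with
    its row 0. Letting both sides act on \<open>v\<close>, which \<open>E ! 0\<close> sends to
    \<eta>, gives \<open>\<phi> ones = \<eta>\<close>.\<close>
  have "first_col_mat ?n ones * ?F = ?F"
    unfolding first_col_mat_mult[OF F]
  proof (rule eq_matI)
    fix i j assume "i < dim_row ?F" "j < dim_col ?F"
    then show "mat ?n ?n (\<lambda>(i, j). ones $ i * ?F $$ (0, j)) $$ (i, j) = ?F $$ (i, j)"
      using F TDD_representation_E0_columns[of i j] by simp
  qed (use F in auto)
  then have "E ! 0 = \<tau> (first_col_mat ?n ones) \<otimes>\<^bsub>M\<^esub> E ! 0"
    using \<tau>_mult[OF first_col_mat_carrier F, of ones] \<tau>_\<sigma>[OF E_closed[of 0]] by (metis le0)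
  then have ones: "\<phi> ones = \<eta>"
    unfolding \<phi>_def v(2) using L.act_mult[OF \<tau>_closed[OF first_col_mat_carrier] E_closed v(1)] by (metis le0)
  \<comment> \<open>If \<phi> killed a nonzero \<open>x\<close>, a matrix moving \<open>x\<close> to
    the all ones vector would force \<eta> to be zero.\<close>
  have zero: "x = 0\<^sub>v ?n" if x: "x \<in> carrier_vec ?n" and "\<phi> x = \<zero>\<^bsub>V\<^esub>" for x
  proof (rule ccontr)
    assume "x \<noteq> 0\<^sub>v ?n"
    then obtain B where B: "B \<in> carrier_mat ?n ?n" "B *\<^sub>v x = ones"
      using mult_mat_vec_transitive[OF x, of ones] by auto
    obtain X where X: "X \<in> carrier M" "\<sigma> X = B"
      using alg_iso_surj[OF iso] B(1) by (auto simp: module_mat_simps)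
    have "\<eta> = act X \<zero>\<^bsub>V\<^esub>"
      using act[OF X(1) x] X(2) B(2) ones \<open>\<phi> x = \<zero>\<^bsub>V\<^esub>\<close> by simp
    also have "act X \<zero>\<^bsub>V\<^esub> = \<zero>\<^bsub>V\<^esub>"
      using L.act_add_right[OF X(1), of "\<zero>\<^bsub>V\<^esub>" "\<zero>\<^bsub>V\<^esub>"] L.act_closed[OF X(1), of "\<zero>\<^bsub>V\<^esub>"] by simp
    finally show False using \<eta>(2) by simp
  qed
  have "inj_on \<phi> (carrier_vec ?n)"
  proof (rule inj_onI)
    fix x y assume xy: "x \<in> carrier_vec ?n" "y \<in> carrier_vec ?n" "\<phi> x = \<phi> y"
    have x: "x = (x - y) + y" using xy by auto
    have "\<phi> (x - y) \<oplus>\<^bsub>V\<^esub> \<phi> y = \<phi> y"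
      using add[of "x - y" y] xy x[symmetric] by simp
    then have "\<phi> (x - y) = \<zero>\<^bsub>V\<^esub>"
      using L.V.add.r_cancel_one[OF closed[of y] closed[of "x - y"]] by blast
    then have "x - y = 0\<^sub>v ?n" using zero[of "x - y"] xy by simp
    with x have "x = 0\<^sub>v ?n + y" by (simp only:)
    then show "x = y" using xy by simp
  qed
  then show thesis using that[of \<phi>] closed add smult act ones by blast
qed

text \<open>\<phi> sends the standard basis to the TD-D basis, because \<open>Estar ! i\<close> cuts
  entry \<open>i\<close> out of the all ones vector. As \<phi> intertwines the actions,
  \<open>\<sigma> X\<close> represents \<open>X\<close>; as it is injective, no other matrix does,
  which settles the definite description.\<close>

lemma TDD_canonical_map_eq:
  assumes V: "left_alg_module M V act"
    and \<eta>: "\<eta> \<in> act (E ! 0) ` carrier V" "\<eta> \<noteq> \<zero>\<^bsub>V\<^esub>" and X: "X \<in> carrier M"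
  shows "TDD_canonical_map \<Phi> V act \<eta> X = \<sigma> X"
proof -
  interpret L: left_alg_module M V act by (rule V)
  let ?n = "Suc d"
  obtain \<phi> where closed: "\<And>x. x \<in> carrier_vec (Suc d) \<Longrightarrow> \<phi> x \<in> carrier V"
    and add: "\<And>x y. x \<in> carrier_vec ?n \<Longrightarrow> y \<in> carrier_vec ?n \<Longrightarrow> \<phi> (x + y) = \<phi> x \<oplus>\<^bsub>V\<^esub> \<phi> y"
    and smult: "\<And>c x. x \<in> carrier_vec ?n \<Longrightarrow> \<phi> (c \<cdot>\<^sub>v x) = c \<odot>\<^bsub>V\<^esub> \<phi> x"
    and act: "\<And>X x. X \<in> carrier M \<Longrightarrow> x \<in> carrier_vec ?n \<Longrightarrow> act X (\<phi> x) = \<phi> (\<sigma> X *\<^sub>v x)"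
    and inj: "inj_on \<phi> (carrier_vec ?n)"
    and ones: "\<phi> ones = \<eta>"
    using TDD_representation_embedding[OF V \<eta>] by blast
  have \<sigma>X: "\<sigma> X \<in> carrier_mat ?n ?n"
    using alg_iso_closed[OF M k_algebra_Mat_alg TDD_representation_iso[OF rep] X]
    by (simp add: module_mat_simps)
  have basis: "TDD_basis \<Phi> act \<eta> i = \<phi> (unit_vec ?n i)" if i: "i \<le> d" for i
  proof -
    have "\<sigma> (Estar ! i) *\<^sub>v ones = unit_vec ?n i"
      unfolding alg_iso_primitive_idempotent[OF M Astar_closed TDD_representation_dual_order[OF rep]
          TDD_representation_iso[OF rep] TDD_representation_Astar[OF rep] i]
    proof (rule eq_vecI)
      fix r assume "r < dim_vec (unit_vec ?n i)"
      then have r: "r < ?n" by simp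
      then have "(mat_diag ?n (\<lambda>k. if k = i then 1 else 0) *\<^sub>v ones) $ r =
          (\<Sum>k\<in>{0..<?n}. if k = r then (if k = i then 1 else 0) else 0)"
        by (simp add: mat_diag_def scalar_prod_def eq_commute del: sum.op_ivl_Suc)
      also have "\<dots> = (if r = i then 1 else 0)" using r by (simp del: sum.op_ivl_Suc)
      finally show "(mat_diag ?n (\<lambda>k. if k = i then 1 else 0) *\<^sub>v ones) $ r = unit_vec ?n i $ r"
        using r i by simp
    qed (simp add: mat_diag_def)
    then show ?thesis
      using act[OF Estar_closed[OF i], of ones] by (simp add: TDD_basis_def ones)
  qed
  \<comment> \<open>Partial sums up to \<open>k\<close> permit induction, with the coefficients
    beyond \<open>k\<close> set to 0; at \<open>k = d\<close> the vector is a whole column.\<close>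
  have comb: "(\<Oplus>\<^bsub>V\<^esub>i\<in>{..k}. c i \<odot>\<^bsub>V\<^esub> \<phi> (unit_vec ?n i)) = \<phi> (vec ?n (\<lambda>i. if i \<le> k then c i else 0))"
    if "k \<le> d" for k and c :: "nat \<Rightarrow> 'k"
    using that
  proof (induction k)
    case 0
    have "vec ?n (\<lambda>i. if i \<le> 0 then c i else 0) = c 0 \<cdot>\<^sub>v unit_vec ?n 0" by (auto intro!: eq_vecI)
    then show ?case using closed by (simp add: smult[symmetric])
  next
    case (Suc k)
    have "vec ?n (\<lambda>i. if i \<le> Suc k then c i else 0) =
        c (Suc k) \<cdot>\<^sub>v unit_vec ?n (Suc k) + vec ?n (\<lambda>i. if i \<le> k then c i else 0)"
      using Suc.prems by (auto intro!: eq_vecI simp: le_Suc_eq)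
    then show ?case
      using Suc closed by (subst L.V.finsum_Suc) (auto simp: smult[symmetric] add)
  qed
  have rep_iff: "represents V act d (TDD_basis \<Phi> act \<eta>) Y X \<longleftrightarrow> Y = \<sigma> X" for Y
  proof -
    have "act X (TDD_basis \<Phi> act \<eta> j) = (\<Oplus>\<^bsub>V\<^esub>i\<in>{..d}. Y $$ (i, j) \<odot>\<^bsub>V\<^esub> TDD_basis \<Phi> act \<eta> i) \<longleftrightarrow>
        col (\<sigma> X) j = col Y j" if j: "j \<le> d" and Y: "Y \<in> carrier_mat ?n ?n" for j
    proof -
      have "(\<Oplus>\<^bsub>V\<^esub>i\<in>{..d}. Y $$ (i, j) \<odot>\<^bsub>V\<^esub> TDD_basis \<Phi> act \<eta> i) =
          (\<Oplus>\<^bsub>V\<^esub>i\<in>{..d}. Y $$ (i, j) \<odot>\<^bsub>V\<^esub> \<phi> (unit_vec ?n i))"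
        by (rule L.V.finsum_cong') (auto simp: basis closed smult[symmetric])
      also have "\<dots> = \<phi> (vec ?n (\<lambda>i. if i \<le> d then Y $$ (i, j) else 0))" by (rule comb) simp
      also have "vec ?n (\<lambda>i. if i \<le> d then Y $$ (i, j) else 0) = col Y j"
        using Y j by (auto intro!: eq_vecI)
      finally have "(\<Oplus>\<^bsub>V\<^esub>i\<in>{..d}. Y $$ (i, j) \<odot>\<^bsub>V\<^esub> TDD_basis \<Phi> act \<eta> i) = \<phi> (col Y j)" .
      moreover have "act X (TDD_basis \<Phi> act \<eta> j) = \<phi> (col (\<sigma> X) j)"
        using j by (simp add: basis act[OF X] mult_mat_unit_vec[OF \<sigma>X])
      ultimately show ?thesis
        using inj_on_eq_iff[OF inj, of "col (\<sigma> X) j" "col Y j"] \<sigma>X Y j by (simp add: carrier_vecI)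
    qed
    then show ?thesis
      unfolding represents_def using \<sigma>X by (auto intro!: mat_col_eqI)
  qed
  show ?thesis unfolding TDD_canonical_map_def rep_iff by simp
qed

end

text \<open>The isomorphism comes with the form; the work is to show that the diagonal of
  \<open>\<sigma> Astar\<close> lists the dual eigenvalues in their own order. The form gives entry
  0, and tridiagonality of \<open>\<sigma> A\<close> propagates the order.\<close>

lemma canonical_form_TDD_representation:
  assumes "TDD_canonical_form_for \<Phi> \<Psi>"
  shows "\<exists>\<sigma> \<theta>s \<theta>s'. TDD_representation \<sigma> \<theta>s \<theta>s' \<and> \<Psi> = map_system (Mat_alg (Suc d)) \<sigma> \<Phi>"
proof -
  let ?n = "Suc d"
  obtain \<sigma> where \<sigma>: "\<sigma> \<in> alg_iso M (ls_alg \<Psi>)" and \<Psi>: "map_system (ls_alg \<Psi>) \<sigma> \<Phi> = \<Psi>"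
    using assms by (auto simp: TDD_canonical_form_for_def isomorphic_systems_def)
  have sel: "ls_d \<Psi> = d" "ls_A \<Psi> = \<sigma> A" "ls_Astar \<Psi> = \<sigma> Astar" "ls_E \<Psi> = map \<sigma> E"
      "ls_Estar \<Psi> = map \<sigma> Estar"
    using arg_cong[OF \<Psi>, of ls_d] arg_cong[OF \<Psi>, of ls_A] arg_cong[OF \<Psi>, of ls_Astar]
      arg_cong[OF \<Psi>, of ls_E] arg_cong[OF \<Psi>, of ls_Estar]
    by (simp_all add: map_system_def)
  have form: "in_TDD_canonical_form \<Psi>" using assms by (simp add: TDD_canonical_form_for_def)
  then have alg: "ls_alg \<Psi> = Mat_alg ?n" by (simp add: in_TDD_canonical_form_def sel)
  note iso = M k_algebra_Mat_alg \<sigma>[unfolded alg]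
  obtain \<theta>s \<theta>s' where \<theta>s: "eigenvalue_sequence \<Psi> \<theta>s" and \<theta>s': "dual_eigenvalue_sequence \<Psi> \<theta>s'"
    and tri: "tridiagonal_mat (\<sigma> A)" and diag: "diagonal_mat (\<sigma> Astar)"
    and sums: "\<And>i. i \<le> d \<Longrightarrow> (\<Sum>j\<le>d. \<sigma> A $$ (i, j)) = \<theta>s ! 0"
    and Astar00: "\<sigma> Astar $$ (0, 0) = \<theta>s' ! 0"
    using form by (auto simp: in_TDD_canonical_form_def sel)
  have seq: "eigenvalue_sequence \<Phi> \<theta>s" and dual: "dual_eigenvalue_sequence \<Phi> \<theta>s'"
    using \<theta>s \<theta>s' eigenvalue_order_alg_iso_iff[OF iso A_closed iso_Mat E_subset]
      eigenvalue_order_alg_iso_iff[OF iso Astar_closed iso_Mat Estar_subset]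
    by (simp_all add: eigenvalue_sequence_def dual_eigenvalue_sequence_def sel alg)
  have order: "eigenvalue_order M d Astar Estar \<theta>s'"
    using dual by (simp add: dual_eigenvalue_sequence_def)
  then have \<theta>s'_props: "distinct \<theta>s'" "length \<theta>s' = ?n"
    and set_\<theta>s': "set \<theta>s' = {\<theta>. eigenvalue (\<sigma> Astar) \<theta>}"
    using alg_eigenvalue_iff[OF M \<sigma>[unfolded alg] Astar_closed] by (auto simp: eigenvalue_order_def)
  have \<sigma>A: "\<sigma> A \<in> carrier_mat ?n ?n" and \<sigma>Astar: "\<sigma> Astar \<in> carrier_mat ?n ?n"
    using alg_iso_closed[OF iso] A_closed Astar_closed by (auto simp: module_mat_simps)
  define b where "b k = \<sigma> Astar $$ (k, k)" for k
  have mat_b: "\<sigma> Astar = mat_diag ?n b"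
    using \<sigma>Astar diag by (auto simp: mat_diag_def b_def diagonal_mat_def intro!: eq_matI)
  have b_eig: "b k \<in> set \<theta>s'" if "k \<le> d" for k
  proof -
    have "mat_diag ?n b *\<^sub>v unit_vec ?n k = b k \<cdot>\<^sub>v unit_vec ?n k"
      using that by (subst mult_mat_unit_vec[of _ ?n]) (auto simp: mat_diag_def intro!: eq_vecI)
    then have "eigenvector (\<sigma> Astar) (unit_vec ?n k) (b k)"
      using that by (auto simp: eigenvector_def mat_b mat_diag_def)
    then show ?thesis unfolding set_\<theta>s' eigenvalue_def by blast
  qed
  have eig_b: "\<exists>k\<le>d. b k = \<theta>" if \<theta>: "\<theta> \<in> set \<theta>s'" for \<theta>
  proof -
    obtain v where v: "v \<in> carrier_vec ?n" "v \<noteq> 0\<^sub>v ?n" "mat_diag ?n b *\<^sub>v v = \<theta> \<cdot>\<^sub>v v"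
      using \<theta> carrier_matD(1)[OF mat_diag_dim[of ?n b]] unfolding set_\<theta>s' mat_b
      by (auto simp: eigenvalue_def eigenvector_def)
    obtain k where k: "k < ?n" "v $ k \<noteq> 0"
      using v by (metis (no_types, lifting) carrier_vecD eq_vecI index_zero_vec)
    have "\<theta> * v $ k = (mat_diag ?n b *\<^sub>v v) $ k" using v k by simp
    also have "\<dots> = (\<Sum>j\<in>{0..<?n}. (if k = j then b j else 0) * v $ j)"
      using k v(1) by (simp add: mat_diag_def scalar_prod_def del: sum.op_ivl_Suc)
    also have "\<dots> = (\<Sum>j\<in>{0..<?n}. if j = k then b j * v $ j else 0)"
      by (rule sum.cong) auto
    also have "\<dots> = b k * v $ k" using k by (simp del: sum.op_ivl_Suc)
    finally show ?thesis using k by (intro exI[of _ k]) auto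
  qed
  \<comment> \<open>A surjection from d + 1 indices onto d + 1 distinct eigenvalues is injective, so
    each dual eigenvalue has exactly one place on the diagonal.\<close>
  have "b ` {..d} = set \<theta>s'" using b_eig eig_b by (auto simp: image_iff)
  then have inj: "inj_on b {..d}"
    using \<theta>s'_props by (intro eq_card_imp_inj_on) (simp_all add: distinct_card)
  \<comment> \<open>For \<open>k = Suc m\<close> let \<open>l\<close> be the place of
    \<open>\<theta>s' ! k\<close>. The product of \<open>Estar ! m\<close>, \<open>A\<close> and
    \<open>Estar ! k\<close> is nonzero, and its image can be nonzero only at \<open>(m, l)\<close>,
    so \<open>l\<close> is \<open>m\<close> or a neighbour of \<open>m\<close>. Distinctness
    excludes \<open>l = m\<close>, and the place just before \<open>m\<close> already holds an
    earlier eigenvalue; hence \<open>l = k\<close>.\<close>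
  have b_eq: "b k = \<theta>s' ! k" if "k \<le> d" for k
    using that
  proof (induction k rule: less_induct)
    case (less k)
    show ?case
    proof (cases k)
      case 0 then show ?thesis using Astar00 by (simp add: b_def)
    next
      case (Suc m)
      then have m: "m \<le> d" "b m = \<theta>s' ! m" using less by auto
      obtain l where l: "l \<le> d" "b l = \<theta>s' ! k"
        using eig_b[of "\<theta>s' ! k"] less.prems \<theta>s'_props by auto
      have "Estar ! m \<otimes>\<^bsub>M\<^esub> A \<otimes>\<^bsub>M\<^esub> Estar ! k \<noteq> \<zero>\<^bsub>M\<^esub>"
        using Estar_sequence m(1) less.prems Suc unfolding idempotent_sequence_def by simp
      then have "\<sigma> (Estar ! m \<otimes>\<^bsub>M\<^esub> A \<otimes>\<^bsub>M\<^esub> Estar ! k) \<noteq> 0\<^sub>m ?n ?n"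
        using alg_iso_eq_zero[OF iso, of "Estar ! m \<otimes>\<^bsub>M\<^esub> A \<otimes>\<^bsub>M\<^esub> Estar ! k"]
          ring.ring_simprules(5)[OF k_algebra_ring[OF M]] Estar_closed m(1) less.prems A_closed
        by (simp add: module_mat_simps)
      moreover have "\<sigma> (Estar ! m \<otimes>\<^bsub>M\<^esub> A \<otimes>\<^bsub>M\<^esub> Estar ! k) =
          mat ?n ?n (\<lambda>(r, c). (if b r = \<theta>s' ! m then 1 else 0) * \<sigma> A $$ (r, c) *
            (if b c = \<theta>s' ! k then 1 else 0))"
        using m(1) less.prems Estar_closed A_closed \<sigma>A
          ring.ring_simprules(5)[OF k_algebra_ring[OF M]]
        by (simp add: alg_iso_mult[OF iso] module_mat_simps mat_diag_mult_both
          alg_iso_primitive_idempotent_diag[OF M Astar_closed order \<sigma>[unfolded alg] mat_b b_eig])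
      ultimately obtain r c where rc: "r \<le> d" "c \<le> d" "b r = \<theta>s' ! m" "b c = \<theta>s' ! k" "\<sigma> A $$ (r, c) \<noteq> 0"
        by (auto simp: mat_eq_iff less_Suc_eq_le split: if_splits)
      then have "r = m" "c = l" using inj m l by (metis atMost_iff inj_on_eq_iff)+
      then have "m = l \<or> m = Suc l \<or> l = Suc m"
        using tri rc \<sigma>A by (auto simp: tridiagonal_mat_def)
      moreover have "m \<noteq> l"
        using m l \<theta>s'_props less.prems Suc by (auto simp: nth_eq_iff_index_eq)
      moreover have "m \<noteq> Suc l"
      proof
        assume "m = Suc l"
        then have "b l = \<theta>s' ! l" using less.IH[of l] Suc l by simp
        then show False using l \<theta>s'_props less.prems Suc \<open>m = Suc l\<close> by (auto simp: nth_eq_iff_index_eq)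
      qed
      ultimately show ?thesis using l Suc by auto
    qed
  qed
  have "\<sigma> Astar = mat_diag ?n (\<lambda>i. \<theta>s' ! i)"
    unfolding mat_b by (auto simp: mat_diag_def b_eq intro!: eq_matI)
  then have "TDD_representation \<sigma> \<theta>s \<theta>s'"
    using \<sigma>[unfolded alg] seq dual sums by (simp add: TDD_representation_def)
  moreover have "\<Psi> = map_system (Mat_alg ?n) \<sigma> \<Phi>" using \<Psi> alg by simp
  ultimately show ?thesis by blast
qed

text \<open>The test module is K^(d+1) with the action through \<sigma>, and \<eta> is the all ones
  vector. The canonical map formed from them does not mention \<tau>, yet on the carrier it equals
  \<tau> as well as \<sigma>.\<close>

lemma TDD_representation_unique:
  assumes \<sigma>: "TDD_representation \<sigma> \<theta>s \<theta>s'" and \<tau>: "TDD_representation \<tau> \<mu>s \<mu>s'" and X: "X \<in> carrier M"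
  shows "\<tau> X = \<sigma> X"
proof -
  let ?V = "module_vec TYPE('k) (Suc d)" and ?act = "\<lambda>X v. \<sigma> X *\<^sub>v v"
  let ?ones = "vec (Suc d) (\<lambda>_. 1 :: 'k)"
  have V: "left_alg_module M ?V ?act"
    using irreducible_left_module_vec[OF M TDD_representation_iso[OF \<sigma>]]
    by (simp add: irreducible_left_module_def)
  have "?ones = ?act (E ! 0) ?ones" using TDD_representation_E0_ones[OF \<sigma>] by simp
  then have in_E0: "?ones \<in> ?act (E ! 0) ` carrier ?V"
    by (rule image_eqI) (simp add: module_vec_simps)
  have "?ones $ 0 \<noteq> 0\<^sub>v (Suc d) $ 0" by simp
  then have nz: "?ones \<noteq> \<zero>\<^bsub>?V\<^esub>" unfolding module_vec_simps by metis
  show ?thesis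
    using TDD_canonical_map_eq[OF \<sigma> V in_E0 nz X] TDD_canonical_map_eq[OF \<tau> V in_E0 nz X] by simp
qed

end

theorem theorem21p6:
  fixes \<Phi> :: "('k::field, 'a) leonard_data"
  assumes "leonard_system \<Phi>"
  shows "(\<exists>!\<Psi>. TDD_canonical_form_for \<Phi> \<Psi>) \<and>
    (\<forall>(V :: ('k, 'v) module) act \<eta>.
       irreducible_left_module (ls_alg \<Phi>) V act \<and>
       \<eta> \<in> act (ls_E \<Phi> ! 0) ` carrier V \<and> \<eta> \<noteq> \<zero>\<^bsub>V\<^esub> \<longrightarrow>
       TDD_canonical_form_for \<Phi>
         (map_system (Mat_alg (Suc (ls_d \<Phi>))) (TDD_canonical_map \<Phi> V act \<eta>) \<Phi>))"
proof -
  interpret leonard \<Phi> by (rule leonard.intro[OF assms])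
  obtain \<sigma> \<theta>s \<theta>s' where \<sigma>: "TDD_representation \<sigma> \<theta>s \<theta>s'" using TDD_representation_exists by blast
  let ?\<Psi> = "map_system (Mat_alg (Suc d)) \<sigma> \<Phi>"
  have form: "TDD_canonical_form_for \<Phi> ?\<Psi>" by (rule TDD_representation_canonical_form[OF \<sigma>])
  have unique: "\<Psi> = ?\<Psi>" if \<Psi>: "TDD_canonical_form_for \<Phi> \<Psi>" for \<Psi>
  proof -
    obtain \<tau> \<mu>s \<mu>s' where \<tau>: "TDD_representation \<tau> \<mu>s \<mu>s'" "\<Psi> = map_system (Mat_alg (Suc d)) \<tau> \<Phi>"
      using canonical_form_TDD_representation[OF \<Psi>] by blast
    show ?thesis
      unfolding \<tau>(2) by (rule map_system_cong[OF assms TDD_representation_unique[OF \<sigma> \<tau>(1)]])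
  qed
  \<comment> \<open>Every choice of \<open>V\<close> and \<eta> computes a map that agrees with
    \<sigma> on the carrier, so all choices give the same system.\<close>
  have flat: "map_system (Mat_alg (Suc d)) (TDD_canonical_map \<Phi> V act \<eta>) \<Phi> = ?\<Psi>"
    if "irreducible_left_module M V act" "\<eta> \<in> act (E ! 0) ` carrier V" "\<eta> \<noteq> \<zero>\<^bsub>V\<^esub>"
    for V :: "('k, 'v) module" and act \<eta>
    using that
    by (intro map_system_cong[OF assms] TDD_canonical_map_eq[OF \<sigma>])
      (auto simp: irreducible_left_module_def)
  show ?thesis
  proof (intro conjI allI impI)
    show "\<exists>!\<Psi>. TDD_canonical_form_for \<Phi> \<Psi>" using form unique by (rule ex1I)
  next
    fix V :: "('k, 'v) module" and act \<eta>
    assume "irreducible_left_module M V act \<and> \<eta> \<in> act (E ! 0) ` carrier V \<and> \<eta> \<noteq> \<zero>\<^bsub>V\<^esub>"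
    then have "map_system (Mat_alg (Suc d)) (TDD_canonical_map \<Phi> V act \<eta>) \<Phi> = ?\<Psi>"
      using flat by (elim conjE)
    then show "TDD_canonical_form_for \<Phi> (map_system (Mat_alg (Suc d)) (TDD_canonical_map \<Phi> V act \<eta>) \<Phi>)"
      using form by (simp only:)
  qed
qed

end
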